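(* Let $\alpha\ge0$. Let $n=n(N)\in\mathbb{N}$ depend on $N$ in such a way that $n/N\to t$ as $N\to\infty$. Let $r_1,\dots,r_m$ depend on $N$ in such a way that $r_i/N\to\ell$ and their differences $r_i-r_j$ are fixed finite constants. Here $t,\ell>0$. Fix $s_1,s_2,\dots,s_m\in\mathbb{N}$ to be finite constants, and let $a_1,\dots,a_m\in\{-\tfrac12,\tfrac12\}$. Let $$\theta=1+\frac{2\ell}{(\ell-t)(2\alpha+\alpha^2)} .$$ Then $$\lim_{N\to\infty}\det[K(r_i,a_i,s_i;r_j,a_j,s_j)]_{i,j=1}^m=\begin{cases}1,&\ell\ge(1-(1+\alpha)^{-2})t,\\[2pt]\det[L(r_i,a_i,s_i,r_j,a_j,s_j;\theta)]_{i,j=1}^m,&\ell<(1-(1+\alpha)^{-2})t,\end{cases}$$ where $K$ is the kernel at time $n$ with parameter $\alpha$ and $L$ is the discrete Jacobi kernel.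
   Context: $\mathbb{N}=\{0,1,2,\dots\}$. For $s\in\mathbb{N}$ define polynomials on $[-1,1]$ (normalized Jacobi polynomials) by $$\mathsf{J}_s^{(1/2,-1/2)}\Big(\frac{z+z^{-1}}2\Big)=\frac{z^{s+1/2}-z^{-s-1/2}}{z^{1/2}-z^{-1/2}},\qquad \mathsf{J}_s^{(-1/2,-1/2)}\Big(\frac{z+z^{-1}}2\Big)=\frac{z^s+z^{-s}}2 .$$ Let $W^{(-1/2,-1/2)}(s)=2$ for $s>0$, $W^{(-1/2,-1/2)}(0)=1$, $W^{(1/2,-1/2)}(s)=1$ for $s\ge0$. Let $\phi_\alpha(x)=\big(1+\alpha(1-x)+\tfrac{\alpha^2}2(1-x)\big)^{-1}$, $\alpha\ge0$. **The kernel $K$ at time $n$.** For positive integers $r_1,r_2$, $a_1,a_2\in\{\pm\frac12\}$, $s_1,s_2\in\mathbb{N}$, $$K(r_1,a_1,s_1;r_2,a_2,s_2)=1_{2r_1+a_1\ge2r_2+a_2}\frac{W^{(a_1,-1/2)}(s_1)}{\pi}\int_{-1}^1\mathsf{J}_{s_1}^{(a_1,-1/2)}(x)\mathsf{J}_{s_2}^{(a_2,-1/2)}(x)(x-1)^{r_1-r_2}(1-x)^{a_1}(1+x)^{-1/2}dx$$ $$+\frac{W^{(a_1,-1/2)}(s_1)}{\pi}\frac1{2\pi i}\int_{-1}^1\oint_C\frac{\phi_\alpha(x)^n}{\phi_\alpha(u)^n}\mathsf{J}_{s_1}^{(a_1,-1/2)}(x)\mathsf{J}_{s_2}^{(a_2,-1/2)}(u)\frac{(x-1)^{r_1}}{(u-1)^{r_2}}\frac{(1-x)^{a_1}(1+x)^{-1/2}\,du\,dx}{x-u},$$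 where $C$ is the $u$-contour, a simple (positively oriented) loop around $[-1,1]$. **The discrete Jacobi kernel $L$.** For $-1<u<1$ and $a_1,a_2\in\{\pm\frac12\}$: if $2r_1+a_1\ge2r_2+a_2$, $$L(r_1,a_1,s_1,r_2,a_2,s_2;u)=\frac{W^{(a_1,-1/2)}(s_1)}{\pi}\int_u^1\mathsf{J}_{s_1}^{(a_1,-1/2)}(x)\mathsf{J}_{s_2}^{(a_2,-1/2)}(x)(x-1)^{r_1-r_2}(1-x)^{a_1}(1+x)^{-1/2}dx;$$ if $2r_1+a_1<2r_2+a_2$, $$L(r_1,a_1,s_1,r_2,a_2,s_2;u)=-\frac{W^{(a_1,-1/2)}(s_1)}{\pi}\int_{-1}^u\mathsf{J}_{s_1}^{(a_1,-1/2)}(x)\mathsf{J}_{s_2}^{(a_2,-1/2)}(x)(x-1)^{r_1-r_2}(1-x)^{a_1}(1+x)^{-1/2}dx .$$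
   Formalization: In the case ℓ ≥ (1-(1+α)^{-2})t the triples (r_i,a_i,s_i) are assumed pairwise distinct; if two coincide, two rows of the matrix are equal and the determinant is 0 for all N, so the limit is 0 rather than 1. *)

theory Defs
  imports "HOL-Complex_Analysis.Complex_Analysis" "HOL-Computational_Algebra.Polynomial"
begin

text \<open>Right-hand side of the defining relation of the normalized Jacobi polynomials
  with parameters \<open>(a, -1/2)\<close>, where \<open>a\<close> is \<open>1/2\<close> or \<open>-1/2\<close>.  Complex \<open>powr\<close> uses the
  principal logarithm for all four powers, so the quotient does not depend on the branch.\<close>

definition jacobi_rhs :: "real \<Rightarrow> nat \<Rightarrow> complex \<Rightarrow> complex" where
  "jacobi_rhs a s z =
     (if a = 1/2
      then (z powr (of_nat s + 1/2) - z powr (- of_nat s - 1/2)) / (z powr (1/2) - z powr (- (1/2)))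
      else (z ^ s + inverse z ^ s) / 2)"

text \<open>The point \<open>z = 1\<close> is excluded because the quotient for \<open>a = 1/2\<close> has a removable
  singularity there; existence and uniqueness are proved below.\<close>

definition jacobi_poly :: "real \<Rightarrow> nat \<Rightarrow> real poly" where
  "jacobi_poly a s =
     (THE p. \<forall>z::complex. z \<noteq> 0 \<longrightarrow> z \<noteq> 1 \<longrightarrow>
        poly (map_poly of_real p) ((z + inverse z) / 2) = jacobi_rhs a s z)"

lemma poly_map_of_real_simps:
  fixes x :: complex
  shows "poly (map_poly of_real (p - q)) x = poly (map_poly of_real p) x - poly (map_poly of_real q) x"
    and "poly (map_poly of_real (p * q)) x = poly (map_poly of_real p) x * poly (map_poly of_real q) x"
proof -
  have "map_poly (of_real :: real \<Rightarrow> complex) (p - q) = map_poly of_real p - map_poly of_real q"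
    by (intro poly_eqI) (simp add: coeff_map_poly)
  moreover have "map_poly (of_real :: real \<Rightarrow> complex) (p * q) = map_poly of_real p * map_poly of_real q"
    by (intro poly_eqI) (simp add: coeff_map_poly coeff_mult)
  ultimately show
    "poly (map_poly of_real (p - q)) x = poly (map_poly of_real p) x - poly (map_poly of_real q) x"
    "poly (map_poly of_real (p * q)) x = poly (map_poly of_real p) x * poly (map_poly of_real q) x"
    by simp_all
qed

lemma jacobi_rhs_half:
  assumes "z \<noteq> 0"
  shows "jacobi_rhs (1/2) s z =
    (csqrt z ^ (2 * s + 1) - inverse (csqrt z) ^ (2 * s + 1)) / (csqrt z - inverse (csqrt z))"
proof -
  define w where "w = exp (Ln z / 2)"
  have w: "csqrt z = w" using assms by (simp add: w_def csqrt_exp_Ln)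
  have *: "z powr (of_nat s + 1/2) = w ^ (2 * s + 1)"
    using assms unfolding w_def powr_def exp_of_nat_mult [symmetric]
    by (simp add: algebra_simps)
  have **: "z powr (- of_nat s - 1/2) = inverse w ^ (2 * s + 1)"
    using assms unfolding w_def powr_def exp_minus [symmetric] exp_of_nat_mult [symmetric]
    by (simp add: algebra_simps)
  have ***: "z powr (1/2) = w" "z powr (- (1/2)) = inverse w"
    using assms by (simp_all add: w_def powr_def exp_minus)
  show ?thesis unfolding jacobi_rhs_def w * ** *** by simp
qed

lemma jacobi_rhs_rec:
  assumes "z \<noteq> 0"
  shows "jacobi_rhs a (Suc (Suc s)) z = (z + inverse z) * jacobi_rhs a (Suc s) z - jacobi_rhs a s z"
proof (cases "a = 1/2")
  case True
  define w where "w = csqrt z"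
  have zw: "z = w ^ 2" by (simp add: w_def)
  have w0: "w \<noteq> 0" using assms zw by auto
  have "w ^ (2 * Suc (Suc s) + 1) - inverse w ^ (2 * Suc (Suc s) + 1) =
        (z + inverse z) * (w ^ (2 * Suc s + 1) - inverse w ^ (2 * Suc s + 1))
        - (w ^ (2 * s + 1) - inverse w ^ (2 * s + 1))"
    using w0 unfolding zw by (simp add: field_simps power2_eq_square)
  then show ?thesis
    unfolding True jacobi_rhs_half[OF assms] w_def[symmetric]
    by (simp add: diff_divide_distrib[symmetric] del: power_Suc)
next
  case False
  then show ?thesis using assms
    by (simp add: jacobi_rhs_def field_simps)
qed

lemma jacobi_poly_exists:
  "\<exists>p::real poly. \<forall>z::complex. z \<noteq> 0 \<longrightarrow> z \<noteq> 1 \<longrightarrow>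
     poly (map_poly of_real p) ((z + inverse z) / 2) = jacobi_rhs a s z"
proof (induction s rule: less_induct)
  case (less s)
  have csq: "csqrt z - inverse (csqrt z) \<noteq> 0" if "z \<noteq> 0" "z \<noteq> 1" for z
  proof
    assume "csqrt z - inverse (csqrt z) = 0"
    then have "csqrt z * csqrt z = 1" using that by (simp add: field_simps)
    then show False using that by (metis power2_csqrt power2_eq_square)
  qed
  consider "s = 0" | "s = 1" | k where "s = Suc (Suc k)"
    by (metis One_nat_def not0_implies_Suc)
  then show ?case
  proof cases
    case 1
    have "jacobi_rhs a s z = 1" if "z \<noteq> 0" "z \<noteq> 1" for z
    proof (cases "a = 1/2")
      case True
      then show ?thesis
        using csq[OF that] by (simp only: 1 True jacobi_rhs_half[OF that(1)]) simp
    qed (simp add: 1 jacobi_rhs_def)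
    then show ?thesis
      by (intro exI[of _ "1"]) (simp add: map_poly_1)
  next
    case 2
    show ?thesis
    proof (cases "a = 1/2")
      case True
      have "poly (map_poly of_real [:1, 2::real:]) ((z + inverse z) / 2) = jacobi_rhs a s z"
        if "z \<noteq> 0" "z \<noteq> 1" for z :: complex
      proof -
        define w where "w = csqrt z"
        have zw: "z = w ^ 2" by (simp add: w_def)
        have w0: "w \<noteq> 0" using that zw by auto
        have "(1 + (z + inverse z)) * (w - inverse w) = w ^ 3 - inverse w ^ 3"
          using w0 unfolding zw by (simp add: field_simps eval_nat_numeral)
        then have "1 + (z + inverse z) = (w ^ 3 - inverse w ^ 3) / (w - inverse w)"
          using csq[OF that] by (simp add: w_def eq_divide_eq)
        then show ?thesis
          unfolding True 2 jacobi_rhs_half[OF that(1)] w_def[symmetric]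
          by (simp add: map_poly_pCons eval_nat_numeral add_divide_distrib)
      qed
      then show ?thesis by blast
    next
      case False
      then show ?thesis unfolding 2
        by (intro exI[of _ "[:0,1:]"]) (auto simp: jacobi_rhs_def map_poly_pCons)
    qed
  next
    case 3
    obtain p q :: "real poly" where
      p: "\<forall>z::complex. z \<noteq> 0 \<longrightarrow> z \<noteq> 1 \<longrightarrow>
            poly (map_poly of_real p) ((z + inverse z) / 2) = jacobi_rhs a (Suc k) z" and
      q: "\<forall>z::complex. z \<noteq> 0 \<longrightarrow> z \<noteq> 1 \<longrightarrow>
            poly (map_poly of_real q) ((z + inverse z) / 2) = jacobi_rhs a k z"
      using less[of "Suc k"] less[of k] 3 by auto
    show ?thesis unfolding 3
      by (intro exI[of _ "[:0, 2:] * p - q"])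
         (simp add: poly_map_of_real_simps p q jacobi_rhs_rec map_poly_pCons
               del: mult_pCons_left)
  qed
qed

lemma jacobi_poly_unique:
  assumes "\<forall>z::complex. z \<noteq> 0 \<longrightarrow> z \<noteq> 1 \<longrightarrow>
             poly (map_poly of_real p) ((z + inverse z) / 2) = jacobi_rhs a s z"
    and "\<forall>z::complex. z \<noteq> 0 \<longrightarrow> z \<noteq> 1 \<longrightarrow>
             poly (map_poly of_real q) ((z + inverse z) / 2) = jacobi_rhs a s z"
  shows "p = q"
proof -
  let ?P = "map_poly of_real p :: complex poly" and ?Q = "map_poly of_real q :: complex poly"
  have "poly ?P y = poly ?Q y" if "y \<noteq> 1" for y
  proof -
    define z where "z = y + csqrt (y\<^sup>2 - 1)"
    have prod: "z * (y - csqrt (y\<^sup>2 - 1)) = 1"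
    proof -
      have "z * (y - csqrt (y\<^sup>2 - 1)) = y\<^sup>2 - (csqrt (y\<^sup>2 - 1))\<^sup>2"
        by (simp add: z_def algebra_simps power2_eq_square)
      then show ?thesis by (simp del: csqrt_square)
    qed
    have z0: "z \<noteq> 0" using prod by auto
    have "inverse z = y - csqrt (y\<^sup>2 - 1)" using prod by (rule inverse_unique)
    then have yz: "(z + inverse z) / 2 = y" by (simp add: z_def)
    moreover have "z \<noteq> 1" using yz that by auto
    ultimately show ?thesis using assms z0 by metis
  qed
  then have "poly ((?P - ?Q) * [:-1, 1:]) y = 0" for y
    by (cases "y = 1") auto
  then have "(?P - ?Q) * [:-1, 1:] = 0" using poly_all_0_iff_0 by blast
  then have "?P - ?Q = 0 \<or> [:-1, 1::complex:] = 0" by (simp only: mult_eq_0_iff)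
  then have "?P = ?Q" by simp
  then have "coeff ?P i = coeff ?Q i" for i by simp
  then show ?thesis by (intro poly_eqI) (simp add: coeff_map_poly)
qed

lemma jacobi_poly:
  fixes z :: complex
  assumes "z \<noteq> 0" "z \<noteq> 1"
  shows "poly (map_poly of_real (jacobi_poly a s)) ((z + inverse z) / 2) = jacobi_rhs a s z"
proof -
  have "\<exists>!p::real poly. \<forall>z::complex. z \<noteq> 0 \<longrightarrow> z \<noteq> 1 \<longrightarrow>
          poly (map_poly of_real p) ((z + inverse z) / 2) = jacobi_rhs a s z"
    using jacobi_poly_exists jacobi_poly_unique by blast
  from theI'[OF this] show ?thesis unfolding jacobi_poly_def using assms by blast
qed

definition jacobi :: "real \<Rightarrow> nat \<Rightarrow> 'a \<Rightarrow> 'a::real_normed_field" where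
  "jacobi a s x = poly (map_poly of_real (jacobi_poly a s)) x"

definition W :: "real \<Rightarrow> nat \<Rightarrow> real" where
  "W a s = (if a = 1/2 then 1 else if s = 0 then 1 else 2)"

definition phi :: "real \<Rightarrow> 'a \<Rightarrow> 'a::real_normed_field" where
  "phi \<alpha> x = inverse (1 + of_real \<alpha> * (1 - x) + of_real (\<alpha>\<^sup>2 / 2) * (1 - x))"

definition jacobi_weight :: "real \<Rightarrow> real \<Rightarrow> real" where
  "jacobi_weight a x = (1 - x) powr a * (1 + x) powr (- 1/2)"

text \<open>A rectifiable (piecewise continuously differentiable), simple, positively oriented loop
  around \<open>S\<close>.  A simple closed path has constant winding number \<open>1\<close> or \<open>-1\<close> about the points it
  encloses; the value \<open>1\<close> is positive orientation.\<close>

definition pos_simple_loop_around :: "(real \<Rightarrow> complex) \<Rightarrow> complex set \<Rightarrow> bool" where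
  "pos_simple_loop_around C S \<longleftrightarrow>
     valid_path C \<and> simple_path C \<and> pathfinish C = pathstart C \<and>
     S \<subseteq> inside (path_image C) \<and>
     (\<forall>z \<in> inside (path_image C). winding_number C z = 1)"

definition pair_integrand :: "nat \<Rightarrow> real \<Rightarrow> nat \<Rightarrow> nat \<Rightarrow> real \<Rightarrow> nat \<Rightarrow> real \<Rightarrow> real" where
  "pair_integrand r1 a1 s1 r2 a2 s2 x =
     jacobi a1 s1 x * jacobi a2 s2 x * (x - 1) powi (int r1 - int r2) * jacobi_weight a1 x"

definition kernel_K ::
  "real \<Rightarrow> nat \<Rightarrow> (real \<Rightarrow> complex) \<Rightarrow> nat \<Rightarrow> real \<Rightarrow> nat \<Rightarrow> nat \<Rightarrow> real \<Rightarrow> nat \<Rightarrow> complex" where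
  "kernel_K \<alpha> n C r1 a1 s1 r2 a2 s2 =
     of_real (if 2 * real r1 + a1 \<ge> 2 * real r2 + a2
              then W a1 s1 / pi * (LBINT x:{-1..1}. pair_integrand r1 a1 s1 r2 a2 s2 x) else 0)
     + of_real (W a1 s1 / pi) * (1 / (2 * of_real pi * \<i>)) *
       (LBINT x:{-1..1}. contour_integral C (\<lambda>u.
          phi \<alpha> (complex_of_real x) ^ n / phi \<alpha> u ^ n
          * jacobi a1 s1 (complex_of_real x) * jacobi a2 s2 u
          * ((complex_of_real x - 1) ^ r1 / (u - 1) ^ r2)
          * of_real (jacobi_weight a1 x) / (complex_of_real x - u)))"

definition kernel_L ::
  "nat \<Rightarrow> real \<Rightarrow> nat \<Rightarrow> nat \<Rightarrow> real \<Rightarrow> nat \<Rightarrow> real \<Rightarrow> real" where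
  "kernel_L r1 a1 s1 r2 a2 s2 u =
     (if 2 * real r1 + a1 \<ge> 2 * real r2 + a2
      then W a1 s1 / pi * (LBINT x:{u..1}. pair_integrand r1 a1 s1 r2 a2 s2 x)
      else - (W a1 s1 / pi) * (LBINT x:{-1..u}. pair_integrand r1 a1 s1 r2 a2 s2 x))"

end

theory Submission
  imports Defs
begin

text \<open>
  The contour integral in \<open>kernel_K\<close> can be evaluated exactly, and the limit theorem becomes the law
  of large numbers for the binomial distribution.

  Put \<open>c = \<alpha> + \<alpha>\<^sup>2 / 2\<close>, so that \<open>1 / \<phi>(u)^n = (1 - c (u - 1))^n\<close> is a polynomial in \<open>u - 1\<close>, and
  expand \<open>J\<^sub>s\<^sub>2(u) = \<Sum>\<^sub>j b\<^sub>j (u - 1)^j\<close>.  The loop integral of \<open>(u - 1)^k / (x - u)\<close> is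
  \<open>- 2 pi i (x - 1)^k\<close> for \<open>k \<ge> 0\<close> and \<open>0\<close> for \<open>k < 0\<close> (\<open>loop_integral_power_over_diff\<close>).  What is left
  of \<open>\<phi>(x)^n / \<phi>(u)^n\<close> after the integration is the truncated binomial sum
  \<open>\<Sum>\<^sub>k (n choose k) (c (1 - x))^k / (1 + c (1 - x))^n\<close> over \<open>k \<ge> r2 - j\<close>, that is,
  \<open>P (Bin (n, p(x)) \<ge> r2 - j)\<close> with \<open>p(x) = c (1 - x) / (1 + c (1 - x))\<close>.  Hence (\<open>kernel_K_eq\<close>), up
  to the factor \<open>W / pi\<close>, the double integral is minus the integral of
  \<open>J\<^sub>s\<^sub>1(x) J\<^sub>s\<^sub>2(x) (x - 1)^(r1 - r2)\<close> against the Jacobi weight, with the \<open>j\<close>-th term of \<open>J\<^sub>s\<^sub>2\<close> weighted by this probability.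

  As \<open>r2 / n\<close> tends to \<open>l / t\<close>, the probability tends to 1 where \<open>p(x) > l / t\<close> and to 0 where
  \<open>p(x) < l / t\<close> (\<open>binomial_tail_lln\<close>).  If \<open>l \<ge> (1 - (1 + \<alpha>)^(-2)) t\<close>, then \<open>p(x) < l / t\<close> on all of
  \<open>(-1, 1)\<close>; otherwise \<open>p(x) > l / t\<close> means \<open>x < \<theta>\<close>.  Near \<open>x = 1\<close>, where \<open>(x - 1)^(r1 - r2)\<close> may be
  singular, the probability is so small that dominated convergence still applies
  (\<open>binomial_tail_dominated\<close>, \<open>tail_integral_limit\<close>).

  In the second case the limit of the entries is \<open>kernel_L\<close>: the double integral tends to
  minus the integral over \<open>[-1, \<theta>]\<close>, which cancels that part of the single integral, if there is one.  In the first case only the single integral survives.  The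
  limit matrix is then block triangular for the order of the values \<open>2 r + a\<close>, its diagonal blocks
  are identity matrices by the orthonormality of the Jacobi polynomials (\<open>jacobi_orthonormal\<close>), and
  its determinant is 1 (\<open>det_triangular_key\<close>).
\<close>

section \<open>Loop integrals of powers against a simple pole\<close>

text \<open>For \<open>k \<ge> 0\<close> this is Cauchy's formula.  For \<open>k < 0\<close> the residues at \<open>w\<close> and \<open>z\<close> cancel; the
  induction on \<open>- k\<close> uses the partial fractions
  \<open>1 / ((u - w) (z - u)) = (1 / (u - w) + 1 / (z - u)) / (z - w)\<close>.  So, up to the factor
  \<open>- 2 pi i\<close>, integrating a Laurent polynomial in \<open>u - w\<close> against \<open>1 / (z - u)\<close> evaluates its
  polynomial part at \<open>z\<close>.\<close>

lemma loop_integral_power_over_diff: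
  fixes z w :: complex and k :: int
  assumes g: "valid_path g" "pathfinish g = pathstart g"
    and off: "z \<notin> path_image g" "w \<notin> path_image g"
    and wn: "winding_number g z = 1" "winding_number g w = 1"
    and "z \<noteq> w"
  shows "((\<lambda>u. (u - w) powi k / (z - u)) has_contour_integral
            (if k \<ge> 0 then - (2 * of_real pi * \<i>) * (z - w) powi k else 0)) g"
proof -
  have sub: "path_image g \<subseteq> UNIV - {v}" if "v \<notin> path_image g" for v
    using that by auto
  have nonneg: "((\<lambda>u. (u - w) ^ m / (z - u)) has_contour_integral
            - (2 * of_real pi * \<i>) * (z - w) ^ m) g" for m
  proof -
    have "((\<lambda>u. (u - w) ^ m / (u - z)) has_contour_integral
            (2 * of_real pi * \<i>) * winding_number g z * (z - w) ^ m) g"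
      using Cauchy_integral_formula_convex_simple[of UNIV "\<lambda>u. (u - w) ^ m" z g] g sub[OF off(1)]
      by (simp add: holomorphic_intros)
    from has_contour_integral_neg[OF this] have "((\<lambda>u. - ((u - w) ^ m / (u - z))) has_contour_integral
            - ((2 * of_real pi * \<i>) * (z - w) ^ m)) g" using wn by simp
    moreover have "- ((u - w) ^ m / (u - z)) = (u - w) ^ m / (z - u)" for u
      by (metis minus_diff_eq minus_divide_right)
    ultimately show ?thesis by simp
  qed
  have polar: "((\<lambda>u. 1 / (u - w) ^ Suc m) has_contour_integral
            (if m = 0 then 2 * of_real pi * \<i> else 0)) g" for m
  proof (cases m)
    case 0
    have "((\<lambda>u. 1 / (u - w)) has_contour_integral
            (2 * of_real pi * \<i>) * winding_number g w * 1) g"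
      using Cauchy_integral_formula_convex_simple[of UNIV "\<lambda>u. 1" w g] g sub[OF off(2)]
      by simp
    then show ?thesis using 0 wn by simp
  next
    case (Suc k)
    have "((\<lambda>u. 1 / (u - w) ^ Suc m) has_contour_integral 0) g"
    proof (rule Cauchy_theorem_primitive[of "UNIV - {w}" "\<lambda>u. - 1 / (of_nat m * (u - w) ^ m)"])
      show "((\<lambda>u. - 1 / (of_nat m * (u - w) ^ m)) has_field_derivative 1 / (x - w) ^ Suc m)
             (at x within UNIV - {w})" if "x \<in> UNIV - {w}" for x
      proof -
        have nz: "x - w \<noteq> 0" "of_nat m \<noteq> (0::complex)" using that Suc
          by (auto simp del: of_nat_Suc)
        have alg: "M * (M * v ^ k) / (M * v ^ Suc k)\<^sup>2 = 1 / v ^ Suc (Suc k)"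
          if "v \<noteq> 0" "M \<noteq> 0" for M v :: complex
          using that by (simp add: divide_simps power2_eq_square)
        have "((\<lambda>u. - 1 / (of_nat m * (u - w) ^ m)) has_field_derivative
                of_nat m * (of_nat m * (x - w) ^ (m - Suc 0)) / (of_nat m * (x - w) ^ m)\<^sup>2)
              (at x within UNIV - {w})"
          using nz by (auto intro!: derivative_eq_intros simp: power2_eq_square)
        then show ?thesis using alg[OF nz] Suc by (simp del: of_nat_Suc power_Suc)
      qed
    qed (use g sub[OF off(2)] in auto)
    then show ?thesis using Suc by simp
  qed
  have neg: "((\<lambda>u. 1 / ((u - w) ^ Suc m * (z - u))) has_contour_integral 0) g" for m
  proof (induction m)
    case (0)
    have "((\<lambda>u. 1 / (z - w) * (1 / (u - w) ^ Suc 0 + (u - w) ^ 0 / (z - u))) has_contour_integral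
            1 / (z - w) * ((2 * of_real pi * \<i>) + (- (2 * of_real pi * \<i>) * (z - w) ^ 0))) g"
      by (intro has_contour_integral_lmul has_contour_integral_add nonneg) (use polar[of 0] in simp)
    then have "((\<lambda>u. 1 / (z - w) * (1 / (u - w) ^ Suc 0 + (u - w) ^ 0 / (z - u)))
        has_contour_integral 0) g" by simp
    then show ?case
    proof (rule has_contour_integral_eq)
      fix u assume "u \<in> path_image g"
      then have "u - w \<noteq> 0" "z - u \<noteq> 0" "z - w \<noteq> 0" using off \<open>z \<noteq> w\<close> by auto
      then show "1 / (z - w) * (1 / (u - w) ^ Suc 0 + (u - w) ^ 0 / (z - u))
                = 1 / ((u - w) ^ Suc 0 * (z - u))"
        by (simp add: add_divide_eq_iff divide_add_eq_iff)
    qed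
  next
    case (Suc m)
    have "((\<lambda>u. 1 / (z - w) * (1 / (u - w) ^ Suc (Suc m) + 1 / ((u - w) ^ Suc m * (z - u))))
            has_contour_integral 1 / (z - w) * (0 + 0)) g"
      by (intro has_contour_integral_lmul has_contour_integral_add Suc) (use polar[of "Suc m"] in simp)
    then have "((\<lambda>u. 1 / (z - w) * (1 / (u - w) ^ Suc (Suc m) + 1 / ((u - w) ^ Suc m * (z - u))))
            has_contour_integral 0) g" by simp
    then show ?case
    proof (rule has_contour_integral_eq)
      fix u assume "u \<in> path_image g"
      then have nz: "u - w \<noteq> 0" "z - u \<noteq> 0" "z - w \<noteq> 0" using off \<open>z \<noteq> w\<close> by auto
      have "1 / (z - w) * (1 / (v * q) + 1 / (q * (z - u))) = 1 / (v * q * (z - u))"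
        if "v = u - w" "q \<noteq> 0" for v q
        using nz that by (simp add: add_divide_eq_iff divide_add_eq_iff)
      from this[OF refl, of "(u - w) ^ Suc m"] nz
      show "1 / (z - w) * (1 / (u - w) ^ Suc (Suc m) + 1 / ((u - w) ^ Suc m * (z - u)))
                = 1 / ((u - w) ^ Suc (Suc m) * (z - u))"
        by simp
    qed
  qed
  show ?thesis
  proof (cases "k \<ge> 0")
    case True
    then show ?thesis using nonneg[of "nat k"] by (simp add: power_int_def)
  next
    case False
    then obtain m where "nat (- k) = Suc m" by (cases "nat (- k)") auto
    then show ?thesis using False neg[of m]
      by (simp add: power_int_def power_inverse divide_simps)
  qed
qed

section \<open>Tails of the binomial distribution\<close>

text \<open>The probability that a binomial variable with \<open>n\<close> trials and success probability \<open>p\<close> is at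
  least \<open>m\<close>, written with the Bernstein polynomials, which are its point probabilities.\<close>

definition binomial_tail :: "nat \<Rightarrow> nat \<Rightarrow> real \<Rightarrow> real" where
  "binomial_tail n m p = (\<Sum>k\<in>{m..n}. Bernstein n k p)"

lemma binomial_tail_nonneg: "0 \<le> p \<Longrightarrow> p \<le> 1 \<Longrightarrow> 0 \<le> binomial_tail n m p"
  unfolding binomial_tail_def by (intro sum_nonneg Bernstein_nonneg)

lemma binomial_tail_le_1:
  assumes "0 \<le> p" "p \<le> 1"
  shows "binomial_tail n m p \<le> 1"
proof -
  have "binomial_tail n m p \<le> (\<Sum>k\<le>n. Bernstein n k p)"
    unfolding binomial_tail_def by (intro sum_mono2) (use assms in \<open>auto intro: Bernstein_nonneg\<close>)
  then show ?thesis by simp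
qed

lemma Bernstein_variance:
  "(\<Sum>k\<le>n. (real k - n * p)\<^sup>2 * Bernstein n k p) = n * p * (1 - p)"
proof -
  have "(\<Sum>k\<le>n. (real k - n * p)\<^sup>2 * Bernstein n k p)
      = (\<Sum>k\<le>n. real k * (real k - 1) * Bernstein n k p + (1 - 2 * n * p) * (real k * Bernstein n k p)
           + (n * p)\<^sup>2 * Bernstein n k p)"
    by (intro sum.cong refl) (simp add: power2_eq_square algebra_simps)
  also have "\<dots> = real n * (real n - 1) * p\<^sup>2 + (1 - 2 * n * p) * (n * p) + (n * p)\<^sup>2"
    by (simp only: sum.distrib sum_distrib_left[symmetric] sum_kk_Bernstein sum_k_Bernstein sum_Bernstein)
  finally show ?thesis by (simp add: power2_eq_square algebra_simps)
qed

text \<open>Chebyshev's inequality for the binomial law, with the variance \<open>n p (1 - p)\<close> bounded by \<open>n\<close>.\<close>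

lemma Bernstein_Chebyshev:
  assumes "0 \<le> p" "p \<le> 1" "0 < e" "0 < n"
    and "A \<subseteq> {..n}" and dev: "\<And>k. k \<in> A \<Longrightarrow> e * n \<le> \<bar>real k - n * p\<bar>"
  shows "(\<Sum>k\<in>A. Bernstein n k p) \<le> 1 / (e\<^sup>2 * n)"
proof -
  have "(e * n)\<^sup>2 * (\<Sum>k\<in>A. Bernstein n k p) \<le> (\<Sum>k\<in>A. (real k - n * p)\<^sup>2 * Bernstein n k p)"
    unfolding sum_distrib_left
  proof (intro sum_mono mult_right_mono)
    fix k assume "k \<in> A"
    show "(e * n)\<^sup>2 \<le> (real k - n * p)\<^sup>2"
      using power_mono[OF dev[OF \<open>k \<in> A\<close>], of 2] assms by simp
  qed (use assms Bernstein_nonneg in auto)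
  also have "\<dots> \<le> (\<Sum>k\<le>n. (real k - n * p)\<^sup>2 * Bernstein n k p)"
    by (intro sum_mono2) (use assms in \<open>auto intro!: mult_nonneg_nonneg Bernstein_nonneg\<close>)
  also have "\<dots> \<le> n"
  proof -
    have "p * (1 - p) \<le> 1 * 1" using assms by (intro mult_mono) auto
    then show ?thesis
      unfolding Bernstein_variance mult.assoc by (simp add: mult_left_le)
  qed
  finally have "(\<Sum>k\<in>A. Bernstein n k p) \<le> n / (e * n)\<^sup>2"
    using assms by (simp add: pos_le_divide_eq mult.commute)
  also have "\<dots> = 1 / (e\<^sup>2 * n)"
    using assms by (simp add: power2_eq_square)
  finally show ?thesis .
qed

text \<open>The weak law of large numbers, for a threshold \<open>m\<close> with \<open>m / n \<longlonglongrightarrow> q\<close>.\<close>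

lemma binomial_tail_lln:
  fixes n m :: "nat \<Rightarrow> nat"
  assumes p: "0 \<le> p" "p \<le> 1" and n: "filterlim n at_top sequentially"
    and ratio: "(\<lambda>N. real (m N) / real (n N)) \<longlonglongrightarrow> q" and "p \<noteq> q"
  shows "(\<lambda>N. binomial_tail (n N) (m N) p) \<longlonglongrightarrow> (if q < p then 1 else 0)"
proof -
  define e where "e = \<bar>p - q\<bar> / 2"
  have e: "0 < e" using \<open>p \<noteq> q\<close> by (simp add: e_def field_simps)
  have n0: "eventually (\<lambda>N. 0 < n N) sequentially"
    using n[unfolded filterlim_at_top, rule_format, of 1] by (rule eventually_mono) simp
  have close: "eventually (\<lambda>N. \<bar>real (m N) / real (n N) - q\<bar> < e) sequentially"
    using tendstoD[OF ratio e] by (simp add: dist_real_def)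
  have lim0: "(\<lambda>N. 1 / (e\<^sup>2 * n N)) \<longlonglongrightarrow> 0"
    using e by (intro real_tendsto_divide_at_top[OF tendsto_const]
        filterlim_tendsto_pos_mult_at_top[OF tendsto_const]
        filterlim_compose[OF filterlim_real_sequentially n]) auto
  have dev: "e * n N \<le> \<bar>real k - n N * p\<bar>"
    if N: "0 < n N" "\<bar>real (m N) / real (n N) - q\<bar> < e"
      and k: "q < p \<and> k < m N \<or> p < q \<and> m N \<le> k" for N k
  proof -
    have mn: "n N * (q - e) < m N" "m N < n N * (q + e)"
    proof -
      have "q - e < m N / n N" "m N / n N < q + e" using N(2) unfolding abs_less_iff by linarith+
      then show "n N * (q - e) < m N" "m N < n N * (q + e)"
        using N(1) by (simp_all add: pos_less_divide_eq pos_divide_less_eq mult.commute)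
    qed
    show ?thesis
    proof (cases "q < p")
      case True
      then have q: "p = q + 2 * e" by (simp add: e_def field_simps)
      have "real k \<le> m N" using k True by auto
      with mn(2) q show ?thesis by (simp add: algebra_simps)
    next
      case False
      then have q: "q = p + 2 * e" using \<open>p \<noteq> q\<close> by (simp add: e_def field_simps)
      have "real k \<ge> m N" using k False by auto
      with mn(1) q show ?thesis by (simp add: algebra_simps)
    qed
  qed
  show ?thesis
  proof (cases "q < p")
    case True
    have "eventually (\<lambda>N. norm (binomial_tail (n N) (m N) p - 1) \<le> 1 / (e\<^sup>2 * n N)) sequentially"
      using n0 close
    proof eventually_elim
      case (elim N)
      have "(\<Sum>k\<in>{..n N} - {m N..n N}. Bernstein (n N) k p) \<le> 1 / (e\<^sup>2 * n N)"
        by (rule Bernstein_Chebyshev[OF p e elim(1)]) (use dev[OF elim] True in auto)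
      moreover have "(\<Sum>k\<in>{..n N} - {m N..n N}. Bernstein (n N) k p) = 1 - binomial_tail (n N) (m N) p"
        unfolding binomial_tail_def by (subst sum_diff) auto
      ultimately show ?case using binomial_tail_le_1[OF p, of "n N" "m N"] by simp
    qed
    then have "(\<lambda>N. binomial_tail (n N) (m N) p - 1) \<longlonglongrightarrow> 0"
      by (rule Lim_null_comparison[OF _ lim0])
    then show ?thesis using True LIM_zero_iff by force
  next
    case False
    have "eventually (\<lambda>N. norm (binomial_tail (n N) (m N) p) \<le> 1 / (e\<^sup>2 * n N)) sequentially"
      using n0 close
    proof eventually_elim
      case (elim N)
      have "binomial_tail (n N) (m N) p \<le> 1 / (e\<^sup>2 * n N)"
        unfolding binomial_tail_def
        by (rule Bernstein_Chebyshev[OF p e elim(1)]) (use dev[OF elim] False \<open>p \<noteq> q\<close> in auto)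
      then show ?case using binomial_tail_nonneg[OF p, of "n N" "m N"] by simp
    qed
    then have "(\<lambda>N. binomial_tail (n N) (m N) p) \<longlonglongrightarrow> 0"
      by (rule Lim_null_comparison[OF _ lim0])
    then show ?thesis using False by simp
  qed
qed

text \<open>The success probability with odds \<open>c w\<close>, where \<open>w = 1 - x\<close> is the distance to the right end
  point of \<open>[-1, 1]\<close> and \<open>c\<close> is the slope of \<open>1 / \<phi>\<close> in \<open>w\<close>.\<close>

definition success_prob :: "real \<Rightarrow> real \<Rightarrow> real" where
  "success_prob c w = c * w / (1 + c * w)"

lemma success_prob_bounds:
  assumes "0 \<le> c" "0 \<le> w"
  shows "0 \<le> success_prob c w" "success_prob c w \<le> 1" "1 - success_prob c w = 1 / (1 + c * w)"
proof -
  have "0 < 1 + c * w" using assms by (simp add: add_pos_nonneg)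
  then show "0 \<le> success_prob c w" "success_prob c w \<le> 1" "1 - success_prob c w = 1 / (1 + c * w)"
    using assms by (auto simp: success_prob_def field_simps)
qed

lemma Bernstein_success_prob:
  assumes "0 \<le> c" "0 \<le> w" "k \<le> n"
  shows "Bernstein n k (success_prob c w) = of_nat (n choose k) * (c * w) ^ k / (1 + c * w) ^ n"
proof -
  have "0 < 1 + c * w" using assms by (simp add: add_pos_nonneg)
  then show ?thesis
    using assms unfolding Bernstein_def success_prob_bounds(3)[OF assms(1,2)]
    by (simp add: success_prob_def power_divide power_add[symmetric] divide_simps)
qed

lemma binomial_tail_small:
  assumes "0 \<le> c" "0 \<le> w" "w \<le> 1"
  shows "binomial_tail n m (success_prob c w) \<le> w ^ m * (1 + c) ^ n"
proof -
  have ge1: "1 \<le> 1 + c * w" using assms by simp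
  have "binomial_tail n m (success_prob c w) \<le> (\<Sum>k\<in>{m..n}. w ^ m * (of_nat (n choose k) * c ^ k))"
    unfolding binomial_tail_def
  proof (rule sum_mono)
    fix k assume k: "k \<in> {m..n}"
    have "Bernstein n k (success_prob c w) = of_nat (n choose k) * (c * w) ^ k / (1 + c * w) ^ n"
      using Bernstein_success_prob[OF assms(1,2)] k by simp
    also have "\<dots> \<le> of_nat (n choose k) * (c * w) ^ k"
      using divide_left_mono[OF one_le_power[OF ge1, of n], of "of_nat (n choose k) * (c * w) ^ k"]
        assms ge1 by simp
    also have "\<dots> \<le> of_nat (n choose k) * (c ^ k * w ^ m)"
      unfolding power_mult_distrib using k assms
      by (intro mult_left_mono power_decreasing) auto
    finally show "Bernstein n k (success_prob c w) \<le> w ^ m * (of_nat (n choose k) * c ^ k)"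
      by (simp add: mult_ac)
  qed
  also have "\<dots> = w ^ m * (\<Sum>k\<in>{m..n}. of_nat (n choose k) * c ^ k)"
    by (simp add: sum_distrib_left)
  also have "\<dots> \<le> w ^ m * (\<Sum>k\<le>n. of_nat (n choose k) * c ^ k)"
    using assms by (intro mult_left_mono sum_mono2) auto
  also have "(\<Sum>k\<le>n. of_nat (n choose k) * c ^ k) = (1 + c) ^ n"
    using binomial_ring[of c 1 n] by (simp add: add.commute)
  finally show ?thesis .
qed

text \<open>Uniformly in \<open>n\<close> and \<open>m\<close> with \<open>n \<le> B m\<close>, the tail vanishes at \<open>w = 0\<close> to any order \<open>e \<le> m\<close>.
  This compensates the pole of \<open>(x - 1) powi (r1 - r2)\<close> at \<open>x = 1\<close> when \<open>r1 < r2\<close>.\<close>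

lemma binomial_tail_dominated:
  assumes c: "0 \<le> c" and w: "0 < w" and nm: "n \<le> B * m" and e: "e \<le> m"
  shows "binomial_tail n m (success_prob c w) \<le> ((1 + c) ^ B * w) ^ e"
proof (cases "(1 + c) ^ B * w \<le> 1")
  case True
  have one: "1 \<le> (1 + c) ^ B" using c by (simp add: one_le_power)
  have "w \<le> (1 + c) ^ B * w" using one w by simp
  then have "w \<le> 1" using True by simp
  then have "binomial_tail n m (success_prob c w) \<le> w ^ m * (1 + c) ^ n"
    using binomial_tail_small[OF c, of w n m] w by simp
  also have "\<dots> \<le> w ^ m * (1 + c) ^ (B * m)"
    using w c nm by (intro mult_left_mono power_increasing) auto
  also have "\<dots> = ((1 + c) ^ B * w) ^ m"
    by (metis power_mult power_mult_distrib mult.commute)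
  also have "\<dots> \<le> ((1 + c) ^ B * w) ^ e"
    using True c w e by (intro power_decreasing) auto
  finally show ?thesis .
next
  case False
  have "binomial_tail n m (success_prob c w) \<le> 1"
    using success_prob_bounds[OF c, of w] w by (intro binomial_tail_le_1) auto
  also have "1 \<le> ((1 + c) ^ B * w) ^ e"
    using False by (intro one_le_power) auto
  finally show ?thesis .
qed

section \<open>Orthonormality of the Jacobi polynomials\<close>

lemma jacobi_real: "jacobi a s (x::real) = poly (jacobi_poly a s) x"
  by (simp add: jacobi_def map_poly_id[unfolded id_def] map_poly_idI)

lemma jacobi_complex_of_real: "jacobi a s (complex_of_real x) = of_real (jacobi a s x)"
  unfolding jacobi_real by (simp add: jacobi_def poly_altdef coeff_map_poly degree_map_poly)

text \<open>The defining relation of the Jacobi polynomials on the unit circle, \<open>z = exp (i \<phi>)\<close>.\<close>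

lemma jacobi_cos_rhs:
  assumes "0 < \<phi>" "\<phi> < pi"
  shows "of_real (jacobi a s (cos \<phi>)) = jacobi_rhs a s (exp (\<i> * of_real \<phi>))"
proof -
  let ?z = "exp (\<i> * of_real \<phi>)"
  have "?z \<noteq> 1"
  proof
    assume "?z = 1"
    then have "Re ?z = 1" by simp
    then have "cos \<phi> = 1" by (simp add: Re_exp)
    moreover have "cos \<phi> < cos 0" using assms by (intro cos_monotone_0_pi) auto
    ultimately show False by simp
  qed
  then have "poly (map_poly of_real (jacobi_poly a s)) ((?z + inverse ?z) / 2) = jacobi_rhs a s ?z"
    by (intro jacobi_poly) auto
  moreover have "(?z + inverse ?z) / 2 = complex_of_real (cos \<phi>)"
    by (simp add: exp_minus[symmetric] cos_exp_eq flip: cos_of_real)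
  ultimately show ?thesis
    unfolding jacobi_complex_of_real[symmetric] by (simp add: jacobi_def)
qed

lemma jacobi_minus_half_cos:
  assumes "0 < \<phi>" "\<phi> < pi"
  shows "jacobi (-1/2) s (cos \<phi>) = cos (s * \<phi>)"
proof -
  have "complex_of_real (jacobi (-1/2) s (cos \<phi>)) = of_real (cos (s * \<phi>))"
    unfolding jacobi_cos_rhs[OF assms]
    by (simp add: jacobi_rhs_def exp_minus[symmetric] cos_exp_eq exp_of_nat_mult[symmetric] mult_ac
          flip: cos_of_real)
  then show ?thesis by (simp only: of_real_eq_iff)
qed

lemma jacobi_half_cos:
  assumes "0 < \<phi>" "\<phi> < pi"
  shows "jacobi (1/2) s (cos \<phi>) * sin (\<phi> / 2) = sin ((s + 1/2) * \<phi>)"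
proof -
  let ?z = "exp (\<i> * of_real \<phi>)"
  have pw: "?z powr of_real b = exp (\<i> * of_real (b * \<phi>))" for b
    using assms by (simp add: powr_def mult_ac)
  have sin_diff: "exp (\<i> * of_real x) - exp (\<i> * of_real (- x)) = 2 * \<i> * of_real (sin x)" for x
    by (simp add: sin_exp_eq flip: sin_of_real)
  have sn: "sin (\<phi> / 2) > 0" using assms by (intro sin_gt_zero) auto
  have "complex_of_real (jacobi (1/2) s (cos \<phi>))
    = (?z powr of_real (s + 1/2) - ?z powr of_real (- (s + 1/2))) / (?z powr of_real (1/2) - ?z powr of_real (- (1/2)))"
    unfolding jacobi_cos_rhs[OF assms] by (simp add: jacobi_rhs_def)
  also have "\<dots> = (2 * \<i> * of_real (sin ((s + 1/2) * \<phi>))) / (2 * \<i> * of_real (sin ((1/2) * \<phi>)))"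
    unfolding pw mult_minus_left sin_diff by (rule refl)
  also have "\<dots> = of_real (sin ((s + 1/2) * \<phi>) / sin (\<phi> / 2))" using sn by simp
  finally have "jacobi (1/2) s (cos \<phi>) = sin ((s + 1/2) * \<phi>) / sin (\<phi> / 2)"
    by (simp only: of_real_eq_iff)
  then show ?thesis using sn by simp
qed

text \<open>The substitution \<open>x = cos \<phi>\<close>, in the form of the fundamental theorem of calculus with the
  antiderivatives \<open>arcsin x\<close> and \<open>- sin (k arccos x) / k\<close>.\<close>

lemma arcsine_weight:
  shows arcsine_weight_integrable:
      "set_integrable lborel {-1..1} (\<lambda>x::real. 1 / sqrt (1 - x\<^sup>2))"
    and arcsine_weight_cos:
      "(LBINT x:{-1..1}. cos (real_of_int k * arccos x) / sqrt (1 - x\<^sup>2)) = (if k = 0 then pi else 0)"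
proof -
  have sq: "0 < 1 - x\<^sup>2" if "-1 < x" "x < 1" for x :: real
    using that by (simp add: abs_square_less_1 abs_less_iff)
  have ein: "einterval (ereal (-1)) (ereal 1) = {-1<..<1}" by (auto simp: einterval_def)
  have lim: "((F \<circ> real_of_ereal) \<longlongrightarrow> F (-1)) (at_right (ereal (-1)))"
            "((F \<circ> real_of_ereal) \<longlongrightarrow> F 1) (at_left (ereal 1))"
    if "continuous_on {-1..1} F" for F :: "real \<Rightarrow> real"
  proof -
    have "(F \<longlongrightarrow> F (-1)) (at (-1) within {-1..1})" "(F \<longlongrightarrow> F 1) (at 1 within {-1..1})"
      using that by (auto simp: continuous_on_def)
    then have "(F \<longlongrightarrow> F (-1)) (at_right (-1))" "(F \<longlongrightarrow> F 1) (at_left 1)"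
      by (simp_all add: at_within_Icc_at_right at_within_Icc_at_left)
    then show "((F \<circ> real_of_ereal) \<longlongrightarrow> F (-1)) (at_right (ereal (-1)))"
            "((F \<circ> real_of_ereal) \<longlongrightarrow> F 1) (at_left (ereal 1))"
      unfolding ereal_tendsto_simps by auto
  qed
  have cont_w: "isCont (\<lambda>x. 1 / sqrt (1 - x\<^sup>2)) x" if "-1 < x" "x < 1" for x :: real
    using sq[OF that] by (auto intro!: continuous_intros)
  have open_int: "set_integrable lborel {-1<..<1} (\<lambda>x::real. 1 / sqrt (1 - x\<^sup>2))"
  proof -
    have "set_integrable lborel (einterval (ereal (-1)) (ereal 1)) (\<lambda>x::real. 1 / sqrt (1 - x\<^sup>2))"
    proof (rule interval_integral_FTC_nonneg(1)[where F = arcsin])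
      show "((arcsin \<circ> real_of_ereal) \<longlongrightarrow> arcsin (-1)) (at_right (ereal (-1)))"
        "((arcsin \<circ> real_of_ereal) \<longlongrightarrow> arcsin 1) (at_left (ereal 1))"
        by (intro lim continuous_on_arcsin' ; simp)+
      show "DERIV arcsin x :> 1 / sqrt (1 - x\<^sup>2)" if "ereal (-1) < ereal x" "ereal x < ereal 1" for x
        using that DERIV_arcsin[of x] by (simp add: divide_inverse)
      show "isCont (\<lambda>x. 1 / sqrt (1 - x\<^sup>2)) x" if "ereal (-1) < ereal x" "ereal x < ereal 1" for x
        using that by (intro cont_w) auto
      show "AE x in lborel. ereal (-1) < ereal x \<longrightarrow> ereal x < ereal 1 \<longrightarrow> 0 \<le> 1 / sqrt (1 - x\<^sup>2)"
        by (intro AE_I2 impI) (use sq in \<open>simp add: less_imp_le\<close>)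
    qed simp
    then show ?thesis by (simp add: ein)
  qed
  show ig: "set_integrable lborel {-1..1} (\<lambda>x::real. 1 / sqrt (1 - x\<^sup>2))"
    using open_int unfolding set_integrable_def
    by (rule Bochner_Integration.integrable_cong[THEN iffD1, rotated -1]) 
       (auto simp: indicator_def le_less)
  have "(LBINT x=ereal (-1)..ereal 1. cos (real_of_int k * arccos x) / sqrt (1 - x\<^sup>2)) = (if k = 0 then pi else 0)"
  proof (cases "k = 0")
    case True
    have "(LBINT x=ereal (-1)..ereal 1. 1 / sqrt (1 - x\<^sup>2)) = arcsin 1 - arcsin (-1)"
    proof (rule interval_integral_FTC_integrable)
      show "((arcsin \<circ> real_of_ereal) \<longlongrightarrow> arcsin (-1)) (at_right (ereal (-1)))"
        "((arcsin \<circ> real_of_ereal) \<longlongrightarrow> arcsin 1) (at_left (ereal 1))"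
        by (intro lim continuous_on_arcsin' ; simp)+
      show "(arcsin has_vector_derivative 1 / sqrt (1 - x\<^sup>2)) (at x)" if "ereal (-1) < ereal x" "ereal x < ereal 1" for x
        using that DERIV_arcsin[of x] by (simp add: divide_inverse has_real_derivative_iff_has_vector_derivative)
      show "isCont (\<lambda>x. 1 / sqrt (1 - x\<^sup>2)) x" if "ereal (-1) < ereal x" "ereal x < ereal 1" for x
        using that by (intro cont_w) auto
    qed (use open_int ein in simp_all)
    then show ?thesis using True by simp
  next
    case False
    define F where "F = (\<lambda>x. - sin (real_of_int k * arccos x) / real_of_int k)"
    have "(LBINT x=ereal (-1)..ereal 1. cos (real_of_int k * arccos x) / sqrt (1 - x\<^sup>2)) = F 1 - F (-1)"
    proof (rule interval_integral_FTC_integrable)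
      have "continuous_on {-1..1} F" unfolding F_def using False
        by (intro continuous_intros continuous_on_arccos') auto
      then show "((F \<circ> real_of_ereal) \<longlongrightarrow> F (-1)) (at_right (ereal (-1)))"
        "((F \<circ> real_of_ereal) \<longlongrightarrow> F 1) (at_left (ereal 1))"
        by (rule lim)+
      show "(F has_vector_derivative cos (real_of_int k * arccos x) / sqrt (1 - x\<^sup>2)) (at x)"
        if "ereal (-1) < ereal x" "ereal x < ereal 1" for x
        unfolding F_def has_real_derivative_iff_has_vector_derivative[symmetric]
        using that False
        by (auto intro!: derivative_eq_intros DERIV_arccos simp: divide_simps)
      show "isCont (\<lambda>x. cos (real_of_int k * arccos x) / sqrt (1 - x\<^sup>2)) x"
        if "ereal (-1) < ereal x" "ereal x < ereal 1" for x
        using that sq[of x] by (auto intro!: continuous_intros isCont_arccos)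
      have "set_integrable lborel {-1<..<1} (\<lambda>x. cos (real_of_int k * arccos x) / sqrt (1 - x\<^sup>2))"
      proof (rule set_integrable_bound[OF open_int])
        show "set_borel_measurable lborel {-1<..<1} (\<lambda>x. cos (real_of_int k * arccos x) / sqrt (1 - x\<^sup>2))"
          using borel_measurable_continuous_on_indicator[of "{-1<..<1}" "\<lambda>x. cos (real_of_int k * arccos x) / sqrt (1 - x\<^sup>2)"] sq
          by (force simp: set_borel_measurable_def intro!: continuous_intros)
        show "AE x in lborel. x \<in> {-1<..<1} \<longrightarrow>
           norm (cos (real_of_int k * arccos x) / sqrt (1 - x\<^sup>2)) \<le> norm (1 / sqrt (1 - x\<^sup>2))"
          by (auto simp: divide_right_mono)
      qed
      then show "set_integrable lborel (einterval (ereal (-1)) (ereal 1)) (\<lambda>x. cos (real_of_int k * arccos x) / sqrt (1 - x\<^sup>2))"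
        by (simp add: ein)
    qed simp
    also have "F 1 - F (-1) = 0" by (simp add: F_def sin_times_pi_eq_0)
    finally show ?thesis using False by simp
  qed
  then show "(LBINT x:{-1..1}. cos (real_of_int k * arccos x) / sqrt (1 - x\<^sup>2)) = (if k = 0 then pi else 0)"
    by (simp add: interval_integral_Icc)
qed

lemma set_integrable_Icc_iff_Ioo:
  fixes f :: "real \<Rightarrow> 'b::{banach, second_countable_topology}"
  shows "set_integrable lborel {a..b} f \<longleftrightarrow> set_integrable lborel {a<..<b} f"
  by (rule set_integrable_discrete_difference[where X = "{a, b}"]) auto

text \<open>No measurability is needed here, because only the two end points are discarded.\<close>

lemma set_integral_Icc_cong_open:
  fixes f g :: "real \<Rightarrow> 'b::{banach, second_countable_topology}"
  assumes "\<And>x. a < x \<Longrightarrow> x < b \<Longrightarrow> f x = g x"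
  shows "(LBINT x:{a..b}. f x) = (LBINT x:{a..b}. g x)"
proof -
  have *: "(LBINT x:{a..b}. h x) = (LBINT x:{a<..<b}. h x)" for h :: "real \<Rightarrow> 'b"
    by (rule set_integral_discrete_difference[where X = "{a, b}"]) auto
  show ?thesis unfolding * by (rule set_lebesgue_integral_cong) (use assms in auto)
qed

lemma jacobi_weight_arcsine:
  assumes "-1 < x" "x < 1" "a \<in> {-1/2, 1/2}"
  shows "jacobi_weight a x = (if a = 1/2 then 1 - x else 1) / sqrt (1 - x\<^sup>2)"
proof -
  have pos: "0 < 1 - x" "0 < 1 + x" using assms by auto
  have sq: "sqrt (1 - x\<^sup>2) = sqrt (1 - x) * sqrt (1 + x)"
    by (simp add: real_sqrt_mult[symmetric] power2_eq_square algebra_simps)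
  have pw: "y powr (1/2) = sqrt y" "y powr (- 1/2) = 1 / sqrt y" if "0 < y" for y
    using that by (simp_all add: powr_half_sqrt powr_minus_divide)
  have self: "sqrt (1 - x) = (1 - x) / sqrt (1 - x)"
    using pos by (simp add: real_div_sqrt)
  consider "a = 1/2" | "a = -1/2" using assms by auto
  then show ?thesis
  proof cases
    case 1
    have "jacobi_weight a x = sqrt (1 - x) * (1 / sqrt (1 + x))"
      unfolding jacobi_weight_def 1 pw(1)[OF pos(1)] pw(2)[OF pos(2)] ..
    then show ?thesis by (subst (asm) self) (simp add: sq 1)
  next
    case 2
    have "jacobi_weight a x = (1 / sqrt (1 - x)) * (1 / sqrt (1 + x))"
      unfolding jacobi_weight_def 2 pw(2)[OF pos(1)] pw(2)[OF pos(2)] ..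
    then show ?thesis using 2 by (simp add: sq)
  qed
qed

lemma jacobi_weight_integrable:
  assumes "a \<in> {-1/2, 1/2}" and g: "continuous_on {-1..1} g"
  shows "set_integrable lborel {-1..1} (\<lambda>x. g x * jacobi_weight a x)"
proof -
  obtain B where B: "\<And>x. x \<in> {-1..1} \<Longrightarrow> \<bar>g x\<bar> \<le> B"
    using compact_imp_bounded[OF compact_continuous_image[OF g]] unfolding bounded_iff by force
  have "set_integrable lborel {-1<..<1} (\<lambda>x. (2 * B) * (1 / sqrt (1 - x\<^sup>2)))"
    using arcsine_weight_integrable unfolding set_integrable_Icc_iff_Ioo
    by (intro set_integrable_mult_right) auto
  then have "set_integrable lborel {-1<..<1} (\<lambda>x. g x * jacobi_weight a x)"
  proof (rule set_integrable_bound)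
    have "continuous_on {-1<..<1} (\<lambda>x. g x * jacobi_weight a x)"
      unfolding jacobi_weight_def
      by (intro continuous_intros continuous_on_subset[OF g]) auto
    then show "set_borel_measurable lborel {-1<..<1} (\<lambda>x. g x * jacobi_weight a x)"
      using borel_measurable_continuous_on_indicator[of "{-1<..<1}" "\<lambda>x. g x * jacobi_weight a x"]
      by (simp add: set_borel_measurable_def)
    show "AE x in lborel. x \<in> {-1<..<1} \<longrightarrow>
        norm (g x * jacobi_weight a x) \<le> norm ((2 * B) * (1 / sqrt (1 - x\<^sup>2)))"
    proof (intro AE_I2 impI)
      fix x :: real assume x: "x \<in> {-1<..<1}"
      have "\<bar>jacobi_weight a x\<bar> \<le> 2 * (1 / sqrt (1 - x\<^sup>2))"
        using x assms(1) by (auto simp: jacobi_weight_arcsine abs_mult abs_square_le_1 intro!: divide_right_mono)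
      moreover have "\<bar>g x\<bar> \<le> B" using B[of x] x by auto
      ultimately have "\<bar>g x * jacobi_weight a x\<bar> \<le> B * (2 * (1 / sqrt (1 - x\<^sup>2)))"
        unfolding abs_mult by (intro mult_mono) auto
      then show "norm (g x * jacobi_weight a x) \<le> norm ((2 * B) * (1 / sqrt (1 - x\<^sup>2)))"
        unfolding real_norm_def by (intro order_trans[OF _ abs_ge_self]) (simp add: mult_ac)
    qed
  qed
  then show ?thesis unfolding set_integrable_Icc_iff_Ioo .
qed

text \<open>The product-to-sum formulas reduce this to the cosine integrals above: with \<open>x = cos \<phi>\<close> and
  \<open>1 - x = 2 sin\<^sup>2 (\<phi> / 2)\<close>, the integrand is \<open>1 / sqrt (1 - x\<^sup>2)\<close> times half the sum of two cosines
  for \<open>a = -1/2\<close>, and times the difference of two cosines for \<open>a = 1/2\<close>.\<close>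

lemma jacobi_orthonormal:
  assumes "a \<in> {-1/2, 1/2}"
  shows "W a s1 / pi * (LBINT x:{-1..1}. jacobi a s1 x * jacobi a s2 x * jacobi_weight a x)
           = (if s1 = s2 then 1 else 0)"
proof -
  define C where "C k x = cos (real_of_int k * arccos x) / sqrt (1 - x\<^sup>2)" for k x
  have Cint: "set_integrable lborel {-1..1} (C k)" for k
    unfolding set_integrable_Icc_iff_Ioo
  proof (rule set_integrable_bound[OF arcsine_weight_integrable[unfolded set_integrable_Icc_iff_Ioo]])
    have "0 < 1 - x\<^sup>2" if "-1 < x" "x < 1" for x :: real
      using that by (simp add: abs_square_less_1 abs_less_iff)
    then show "set_borel_measurable lborel {-1<..<1} (C k)"
      using borel_measurable_continuous_on_indicator[of "{-1<..<1}" "C k"] unfolding C_def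
      by (force simp: set_borel_measurable_def intro!: continuous_intros)
    show "AE x in lborel. x \<in> {-1<..<1} \<longrightarrow> norm (C k x) \<le> norm (1 / sqrt (1 - x\<^sup>2))"
      unfolding C_def by (auto simp: divide_right_mono)
  qed
  have Cval: "(LBINT x:{-1..1}. C k x) = (if k = 0 then pi else 0)" for k
    unfolding C_def by (rule arcsine_weight_cos)
  consider "a = -1/2" | "a = 1/2" using assms by auto
  then show ?thesis
  proof cases
    case 1
    have "(LBINT x:{-1..1}. jacobi a s1 x * jacobi a s2 x * jacobi_weight a x)
        = (LBINT x:{-1..1}. 1/2 * C (int s1 - int s2) x + 1/2 * C (int s1 + int s2) x)"
    proof (rule set_integral_Icc_cong_open)
      fix x :: real assume x: "-1 < x" "x < 1"
      define \<phi> where "\<phi> = arccos x"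
      have \<phi>: "0 < \<phi>" "\<phi> < pi" "x = cos \<phi>"
        using arccos_lt_bounded[OF x] x by (simp_all add: \<phi>_def)
      have "jacobi a s1 x * jacobi a s2 x = cos (s1 * \<phi>) * cos (s2 * \<phi>)"
        unfolding 1 \<phi>(3) using jacobi_minus_half_cos[OF \<phi>(1,2)] by simp
      also have "\<dots> = (cos ((real s1 - s2) * \<phi>) + cos ((real s1 + s2) * \<phi>)) / 2"
        by (simp add: cos_times_cos left_diff_distrib distrib_right)
      finally show "jacobi a s1 x * jacobi a s2 x * jacobi_weight a x
          = 1/2 * C (int s1 - int s2) x + 1/2 * C (int s1 + int s2) x"
        unfolding jacobi_weight_arcsine[OF x assms] using 1
        by (simp add: C_def \<phi>_def add_divide_distrib)
    qed
    also have "\<dots> = 1/2 * (LBINT x:{-1..1}. C (int s1 - int s2) x) + 1/2 * (LBINT x:{-1..1}. C (int s1 + int s2) x)"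
      using Cint by (subst set_integral_add) auto
    finally show ?thesis unfolding Cval using 1 by (auto simp: W_def)
  next
    case 2
    have "(LBINT x:{-1..1}. jacobi a s1 x * jacobi a s2 x * jacobi_weight a x)
        = (LBINT x:{-1..1}. C (int s1 - int s2) x - C (int s1 + int s2 + 1) x)"
    proof (rule set_integral_Icc_cong_open)
      fix x :: real assume x: "-1 < x" "x < 1"
      define \<phi> where "\<phi> = arccos x"
      have \<phi>: "0 < \<phi>" "\<phi> < pi" "x = cos \<phi>"
        using arccos_lt_bounded[OF x] x by (simp_all add: \<phi>_def)
      have "jacobi a s1 x * jacobi a s2 x * (1 - x)
          = 2 * (jacobi a s1 x * sin (\<phi> / 2)) * (jacobi a s2 x * sin (\<phi> / 2))"
        using cos_double_sin[of "\<phi> / 2"] by (simp add: \<phi>(3) power2_eq_square)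
      also have "\<dots> = 2 * sin ((s1 + 1/2) * \<phi>) * sin ((s2 + 1/2) * \<phi>)"
        unfolding 2 \<phi>(3) jacobi_half_cos[OF \<phi>(1,2)] ..
      also have "\<dots> = cos ((real s1 - s2) * \<phi>) - cos ((real s1 + s2 + 1) * \<phi>)"
        by (simp add: mult.assoc add_ac sin_times_sin left_diff_distrib distrib_right)
      finally show "jacobi a s1 x * jacobi a s2 x * jacobi_weight a x
          = C (int s1 - int s2) x - C (int s1 + int s2 + 1) x"
        unfolding jacobi_weight_arcsine[OF x assms]
        by (simp add: 2 C_def \<phi>_def diff_divide_distrib[symmetric])
    qed
    also have "\<dots> = (LBINT x:{-1..1}. C (int s1 - int s2) x) - (LBINT x:{-1..1}. C (int s1 + int s2 + 1) x)"
      using Cint by (subst set_integral_diff) auto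
    finally show ?thesis unfolding Cval 2 by (auto simp: W_def)
  qed
qed

section \<open>Evaluation of the contour integral in the kernel\<close>

text \<open>The polynomial whose coefficients are those of the Jacobi polynomial expanded about \<open>x = 1\<close>.\<close>

definition shifted_jacobi :: "real \<Rightarrow> nat \<Rightarrow> real poly" where
  "shifted_jacobi a s = jacobi_poly a s \<circ>\<^sub>p [:1, 1:]"

lemma jacobi_eq_shifted:
  "jacobi a s (u :: complex) =
     (\<Sum>j\<le>degree (shifted_jacobi a s). of_real (coeff (shifted_jacobi a s) j) * (u - 1) ^ j)"
proof -
  have pc: "poly (map_poly complex_of_real (p \<circ>\<^sub>p [:1, 1:])) v = poly (map_poly of_real p) (1 + v)" for p v
  proof (induction p)
    case (pCons a p)
    have add: "map_poly complex_of_real (f + g) = map_poly of_real f + map_poly of_real g" for f g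
      by (intro poly_eqI) (simp add: coeff_map_poly)
    show ?case
      by (simp add: pcompose_pCons add poly_map_of_real_simps(2) map_poly_pCons pCons.IH
               del: mult_pCons_left)
  qed simp
  have "jacobi a s u = poly (map_poly of_real (shifted_jacobi a s)) (u - 1)"
    unfolding shifted_jacobi_def pc by (simp add: jacobi_def)
  also have "\<dots> = (\<Sum>j\<le>degree (shifted_jacobi a s). of_real (coeff (shifted_jacobi a s) j) * (u - 1) ^ j)"
    by (simp add: poly_altdef degree_map_poly coeff_map_poly)
  finally show ?thesis .
qed

lemma jacobi_eq_poly_shifted: "jacobi a s (x :: real) = poly (shifted_jacobi a s) (x - 1)"
  by (simp add: shifted_jacobi_def poly_pcompose jacobi_real)

text \<open>The constant \<open>c\<close> with \<open>1 / \<phi>(x) = 1 + c (1 - x)\<close>.\<close>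

definition phi_slope :: "real \<Rightarrow> real" where
  "phi_slope \<alpha> = \<alpha> + \<alpha>\<^sup>2 / 2"

lemma phi_eq: "phi \<alpha> (u :: complex) = inverse (1 - of_real (phi_slope \<alpha>) * (u - 1))"
  unfolding phi_def phi_slope_def by (rule arg_cong[of _ _ inverse]) (simp add: field_simps)

text \<open>The \<open>x\<close>-integrand of the double integral in \<open>kernel_K\<close> after the \<open>u\<close>-integration, up to the
  factor \<open>- 2 pi i\<close>.
  It is the integrand \<open>pair_integrand\<close> with its factor \<open>J\<^sub>s\<^sub>2(x) = \<Sum>\<^sub>j b\<^sub>j (x - 1)^j\<close> replaced by the same sum
  with the \<open>j\<close>-th term multiplied by \<open>P (Bin (n, p(x)) \<ge> r2 - j)\<close>.  The truncated difference
  \<open>r2 - j\<close> of natural numbers is harmless, as a nonpositive threshold gives probability 1.\<close>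

definition tail_integrand ::
  "real \<Rightarrow> nat \<Rightarrow> nat \<Rightarrow> real \<Rightarrow> nat \<Rightarrow> nat \<Rightarrow> real \<Rightarrow> nat \<Rightarrow> real \<Rightarrow> real" where
  "tail_integrand \<alpha> n r1 a1 s1 r2 a2 s2 x =
     jacobi a1 s1 x * jacobi_weight a1 x * ((x - 1) powi (int r1 - int r2) *
       (\<Sum>j\<le>degree (shifted_jacobi a2 s2). coeff (shifted_jacobi a2 s2) j * (x - 1) ^ j *
          binomial_tail n (r2 - j) (success_prob (phi_slope \<alpha>) (1 - x))))"

lemma binomial_tail_diff:
  "binomial_tail n (m - j) p = (\<Sum>k\<le>n. if m \<le> k + j then Bernstein n k p else 0)"
  unfolding binomial_tail_def by (rule sum.mono_neutral_cong_left) auto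

text \<open>The integrand is a Laurent polynomial in \<open>u - 1\<close> divided by \<open>x - u\<close>, and the loop integral keeps
  the nonnegative powers.  The powers \<open>k\<close> of \<open>(1 - c (u - 1))^n\<close> that survive next to
  \<open>(u - 1)^j / (u - 1)^r2\<close> are those with \<open>k + j \<ge> r2\<close>, and together with \<open>\<phi>(x)^n\<close> their
  coefficients are binomial probabilities.\<close>

lemma kernel_contour_integral:
  assumes C: "pos_simple_loop_around C (complex_of_real ` {-1..1})"
    and x: "-1 < x" "x < 1" and \<alpha>: "0 \<le> \<alpha>"
  shows "contour_integral C (\<lambda>u.
          phi \<alpha> (complex_of_real x) ^ n / phi \<alpha> u ^ n
          * jacobi a1 s1 (complex_of_real x) * jacobi a2 s2 u
          * ((complex_of_real x - 1) ^ r1 / (u - 1) ^ r2)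
          * of_real (jacobi_weight a1 x) / (complex_of_real x - u))
       = - (2 * of_real pi * \<i>) * of_real (tail_integrand \<alpha> n r1 a1 s1 r2 a2 s2 x)"
proof -
  define c where "c = phi_slope \<alpha>"
  define q where "q = shifted_jacobi a2 s2"
  define w where "w = 1 - x"
  have c0: "0 \<le> c" using \<alpha> by (simp add: c_def phi_slope_def)
  have w0: "0 < w" using x by (simp add: w_def)
  have pos: "0 < 1 + c * w" using c0 w0 by (simp add: add_pos_nonneg)
  have inside: "complex_of_real y \<in> inside (path_image C)" if "y \<in> {-1..1}" for y
    using C that unfolding pos_simple_loop_around_def by blast
  have off: "complex_of_real y \<notin> path_image C" "winding_number C (complex_of_real y) = 1"
    if "y \<in> {-1..1}" for y
    using inside[OF that] inside_no_overlap[of "path_image C"] C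
    unfolding pos_simple_loop_around_def by blast+
  define P where "P = complex_of_real (jacobi a1 s1 x * jacobi_weight a1 x * (x - 1) ^ r1 / (1 + c * w) ^ n)"
  define B where "B j k = P * of_real (coeff q j * of_nat (n choose k) * (- c) ^ k)" for j k
  define V where "V e = (if e \<ge> 0 then - (2 * of_real pi * \<i>) * (complex_of_real x - 1) powi e else 0)"
    for e :: int
  have base: "((\<lambda>u. (u - 1) powi e / (complex_of_real x - u)) has_contour_integral V e) C" for e
    unfolding V_def using C off[of x] off[of 1] x
    by (intro loop_integral_power_over_diff) (auto simp: pos_simple_loop_around_def)
  have "((\<lambda>u. \<Sum>j\<le>degree q. \<Sum>k\<le>n. B j k * ((u - 1) powi (int k + int j - int r2) / (complex_of_real x - u)))
      has_contour_integral (\<Sum>j\<le>degree q. \<Sum>k\<le>n. B j k * V (int k + int j - int r2))) C"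
    by (intro has_contour_integral_sum has_contour_integral_lmul base) auto
  then have "((\<lambda>u. phi \<alpha> (complex_of_real x) ^ n / phi \<alpha> u ^ n
          * jacobi a1 s1 (complex_of_real x) * jacobi a2 s2 u
          * ((complex_of_real x - 1) ^ r1 / (u - 1) ^ r2)
          * of_real (jacobi_weight a1 x) / (complex_of_real x - u))
      has_contour_integral (\<Sum>j\<le>degree q. \<Sum>k\<le>n. B j k * V (int k + int j - int r2))) C"
  proof (rule has_contour_integral_eq)
    fix u assume "u \<in> path_image C"
    then have u1: "u - 1 \<noteq> 0" using off(1)[of 1] by auto
    have "1 / phi \<alpha> u ^ n = (of_real (- c) * (u - 1) + 1) ^ n"
      by (simp add: phi_eq c_def power_inverse divide_inverse)
    also have "\<dots> = (\<Sum>k\<le>n. of_nat (n choose k) * of_real (- c) ^ k * (u - 1) ^ k)"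
      unfolding binomial_ring power_mult_distrib by (simp add: mult_ac)
    finally have ph: "1 / phi \<alpha> u ^ n = (\<Sum>k\<le>n. of_nat (n choose k) * of_real (- c) ^ k * (u - 1) ^ k)" .
    have phx: "phi \<alpha> (complex_of_real x) ^ n = of_real (1 / (1 + c * w) ^ n)"
      by (simp add: phi_eq c_def w_def power_inverse divide_inverse algebra_simps)
    have pw: "(u - 1) ^ k * (u - 1) ^ j / (u - 1) ^ r2 = (u - 1) powi (int k + int j - int r2)" for j k
      using u1 by (simp add: power_int_diff power_int_add)
    have "phi \<alpha> (complex_of_real x) ^ n / phi \<alpha> u ^ n
          * jacobi a1 s1 (complex_of_real x) * jacobi a2 s2 u
          * ((complex_of_real x - 1) ^ r1 / (u - 1) ^ r2)
          * of_real (jacobi_weight a1 x) / (complex_of_real x - u)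
        = P * (jacobi a2 s2 u * (1 / phi \<alpha> u ^ n)) * (1 / (u - 1) ^ r2) / (complex_of_real x - u)"
      unfolding phx P_def jacobi_complex_of_real by simp
    also have "\<dots> = (\<Sum>j\<le>degree q. \<Sum>k\<le>n. B j k * ((u - 1) powi (int k + int j - int r2) / (complex_of_real x - u)))"
      unfolding ph jacobi_eq_shifted q_def[symmetric] sum_product sum_distrib_left sum_distrib_right
        sum_divide_distrib
      by (subst sum.swap, intro sum.cong refl) (simp add: pw[symmetric] B_def)
    finally show "(\<Sum>j\<le>degree q. \<Sum>k\<le>n. B j k * ((u - 1) powi (int k + int j - int r2) / (complex_of_real x - u)))
      = phi \<alpha> (complex_of_real x) ^ n / phi \<alpha> u ^ n
          * jacobi a1 s1 (complex_of_real x) * jacobi a2 s2 u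
          * ((complex_of_real x - 1) ^ r1 / (u - 1) ^ r2)
          * of_real (jacobi_weight a1 x) / (complex_of_real x - u)" ..
  qed
  then have "contour_integral C (\<lambda>u. phi \<alpha> (complex_of_real x) ^ n / phi \<alpha> u ^ n
          * jacobi a1 s1 (complex_of_real x) * jacobi a2 s2 u
          * ((complex_of_real x - 1) ^ r1 / (u - 1) ^ r2)
          * of_real (jacobi_weight a1 x) / (complex_of_real x - u))
      = (\<Sum>j\<le>degree q. \<Sum>k\<le>n. B j k * V (int k + int j - int r2))"
    by (rule contour_integral_unique)
  also have "\<dots> = - (2 * of_real pi * \<i>) * of_real (tail_integrand \<alpha> n r1 a1 s1 r2 a2 s2 x)"
  proof -
    have "B j k * V (int k + int j - int r2) = - (2 * of_real pi * \<i>) *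
        of_real (jacobi a1 s1 x * jacobi_weight a1 x * ((x - 1) powi (int r1 - int r2) *
          (coeff q j * (x - 1) ^ j * (if r2 \<le> k + j then Bernstein n k (success_prob c w) else 0))))"
      if "k \<le> n" for j k
    proof (cases "r2 \<le> k + j")
      case True
      have y: "x - 1 \<noteq> 0" using x by simp
      have "(x - 1) ^ r1 * (x - 1) powi (int k + int j - int r2) =
          (x - 1) powi (int r1 - int r2) * (x - 1) ^ j * (x - 1) ^ k"
        using y by (simp add: power_int_diff power_int_add)
      moreover have cw: "(c * w) ^ k = (- c) ^ k * (x - 1) ^ k"
        unfolding power_mult_distrib[symmetric] by (simp add: w_def algebra_simps)
      ultimately have eq: "(x - 1) ^ r1 * (- c) ^ k * (x - 1) powi (int k + int j - int r2) =
          (x - 1) powi (int r1 - int r2) * (x - 1) ^ j * (c * w) ^ k"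
        unfolding cw by (simp add: mult_ac)
      have Vval: "V (int k + int j - int r2) =
          - (2 * of_real pi * \<i>) * of_real ((x - 1) powi (int k + int j - int r2))"
        using True by (simp add: V_def of_real_power_int)
      have "jacobi a1 s1 x * jacobi_weight a1 x * (x - 1) ^ r1 / (1 + c * w) ^ n *
            (coeff q j * of_nat (n choose k) * (- c) ^ k) * (x - 1) powi (int k + int j - int r2)
          = jacobi a1 s1 x * jacobi_weight a1 x * coeff q j * of_nat (n choose k) / (1 + c * w) ^ n *
             ((x - 1) ^ r1 * (- c) ^ k * (x - 1) powi (int k + int j - int r2))"
        by (simp add: mult_ac)
      also have "\<dots> = jacobi a1 s1 x * jacobi_weight a1 x * ((x - 1) powi (int r1 - int r2) *
          (coeff q j * (x - 1) ^ j * Bernstein n k (success_prob c w)))"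
        unfolding eq using Bernstein_success_prob[OF c0 less_imp_le[OF w0] that] by (simp add: mult_ac)
      finally have X: "jacobi a1 s1 x * jacobi_weight a1 x * (x - 1) ^ r1 / (1 + c * w) ^ n *
            (coeff q j * of_nat (n choose k) * (- c) ^ k) * (x - 1) powi (int k + int j - int r2) = \<dots>" .
      have "B j k * V (int k + int j - int r2) = - (2 * of_real pi * \<i>) *
          of_real (jacobi a1 s1 x * jacobi_weight a1 x * (x - 1) ^ r1 / (1 + c * w) ^ n *
            (coeff q j * of_nat (n choose k) * (- c) ^ k) * (x - 1) powi (int k + int j - int r2))"
        unfolding B_def P_def Vval of_real_mult by (simp only: mult_ac)
      then show ?thesis unfolding X using True by simp
    next
      case False
      then show ?thesis by (simp add: V_def)
    qed
    then show ?thesis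
      unfolding tail_integrand_def c_def[symmetric] q_def[symmetric] w_def[symmetric] binomial_tail_diff
      by (simp add: sum_distrib_left)
  qed
  finally show ?thesis .
qed

lemma kernel_K_eq:
  assumes C: "pos_simple_loop_around C (complex_of_real ` {-1..1})" and \<alpha>: "0 \<le> \<alpha>"
  shows "kernel_K \<alpha> n C r1 a1 s1 r2 a2 s2 = of_real
    ((if 2 * real r1 + a1 \<ge> 2 * real r2 + a2
      then W a1 s1 / pi * (LBINT x:{-1..1}. pair_integrand r1 a1 s1 r2 a2 s2 x) else 0)
     - W a1 s1 / pi * (LBINT x:{-1..1}. tail_integrand \<alpha> n r1 a1 s1 r2 a2 s2 x))"
proof -
  have "(LBINT x:{-1..1}. contour_integral C (\<lambda>u.
          phi \<alpha> (complex_of_real x) ^ n / phi \<alpha> u ^ n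
          * jacobi a1 s1 (complex_of_real x) * jacobi a2 s2 u
          * ((complex_of_real x - 1) ^ r1 / (u - 1) ^ r2)
          * of_real (jacobi_weight a1 x) / (complex_of_real x - u)))
      = (LBINT x:{-1..1}. - (2 * of_real pi * \<i>) * of_real (tail_integrand \<alpha> n r1 a1 s1 r2 a2 s2 x))"
    by (intro set_integral_Icc_cong_open kernel_contour_integral C \<alpha>)
  also have "\<dots> = - (2 * of_real pi * \<i>) * of_real (LBINT x:{-1..1}. tail_integrand \<alpha> n r1 a1 s1 r2 a2 s2 x)"
    by (simp only: set_integral_mult_right set_integral_complex_of_real)
  finally show ?thesis unfolding kernel_K_def by simp
qed

section \<open>Limit of the tail integrals\<close>

lemma binomial_tail_powi_bound:
  fixes d :: int
  assumes c: "0 \<le> c" and w: "0 < w" "w \<le> 2" and nm: "n \<le> B * m" and e: "nat (- d) \<le> m"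
  shows "\<bar>(- w) powi d * binomial_tail n m (success_prob c w)\<bar> \<le> 2 ^ nat d * ((1 + c) ^ B) ^ nat (- d)"
proof -
  have nn: "0 \<le> binomial_tail n m (success_prob c w)" "binomial_tail n m (success_prob c w) \<le> 1"
    using success_prob_bounds[OF c, of w] w
    by (auto intro!: binomial_tail_nonneg binomial_tail_le_1)
  show ?thesis
  proof (cases "d \<ge> 0")
    case True
    have "w ^ nat d * binomial_tail n m (success_prob c w) \<le> 2 ^ nat d * 1"
      using w nn by (intro mult_mono power_mono) auto
    then show ?thesis using True w nn by (simp add: power_int_def abs_mult power_abs)
  next
    case False
    have "binomial_tail n m (success_prob c w) \<le> ((1 + c) ^ B * w) ^ nat (- d)"
      by (rule binomial_tail_dominated[OF c w(1) nm e])
    then have "inverse w ^ nat (- d) * binomial_tail n m (success_prob c w)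
        \<le> inverse w ^ nat (- d) * ((1 + c) ^ B * w) ^ nat (- d)"
      using w by (intro mult_left_mono) auto
    also have "\<dots> = ((1 + c) ^ B) ^ nat (- d)"
    proof -
      have "inverse w * ((1 + c) ^ B * w) = (1 + c) ^ B" using w by (simp add: field_simps)
      then show ?thesis by (simp only: power_mult_distrib[symmetric])
    qed
    finally show ?thesis using False w nn
      by (simp add: power_int_def abs_mult power_abs)
  qed
qed

lemma borel_measurable_power_int [measurable]:
  fixes f :: "'a \<Rightarrow> real"
  assumes [measurable]: "f \<in> borel_measurable M"
  shows "(\<lambda>x. f x powi d) \<in> borel_measurable M"
  by (cases "d \<ge> 0") (simp_all add: power_int_def)

lemma borel_measurable_binomial_tail [measurable]:
  assumes [measurable]: "f \<in> borel_measurable M"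
  shows "(\<lambda>x. binomial_tail n m (success_prob c (f x))) \<in> borel_measurable M"
  unfolding binomial_tail_def Bernstein_def success_prob_def by measurable

text \<open>The law of large numbers gives the pointwise limit, and dominated convergence carries it over to
  the integral.\<close>

lemma tail_integral_limit:
  fixes n r :: "nat \<Rightarrow> nat" and q :: "real poly" and d :: int
  assumes c: "0 \<le> c" and h: "set_integrable lborel {-1..1} h"
    and n: "filterlim n at_top sequentially"
    and ratio: "(\<lambda>N. real (r N) / real (n N)) \<longlonglongrightarrow> \<rho>" and "0 < \<rho>"
    and generic: "AE x in lborel. x \<in> {-1<..<1} \<longrightarrow> success_prob c (1 - x) \<noteq> \<rho>"
  shows "(\<lambda>N. LBINT x:{-1..1}. h x * ((x - 1) powi d *
            (\<Sum>j\<le>degree q. coeff q j * (x - 1) ^ j * binomial_tail (n N) (r N - j) (success_prob c (1 - x)))))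
       \<longlonglongrightarrow> (LBINT x:{-1..1}. if \<rho> < success_prob c (1 - x) then h x * ((x - 1) powi d * poly q (x - 1)) else 0)"
proof -
  \<comment> \<open>Eventually \<open>r \<ge> (\<rho> / 2) n\<close>, and lowering \<open>r\<close> by the bounded amount \<open>j\<close> costs at most another
    factor 2, so that \<open>n \<le> B (r - j)\<close>.\<close>
  define B where "B = nat \<lceil>4 / \<rho>\<rceil>"
  define S where "S = (\<Sum>j\<le>degree q. \<bar>coeff q j\<bar> * 2 ^ j)"
  define M where "M = 2 ^ nat d * ((1 + c) ^ B) ^ nat (- d)"
  define G where "G N x = (x - 1) powi d *
      (\<Sum>j\<le>degree q. coeff q j * (x - 1) ^ j * binomial_tail (n N) (r N - j) (success_prob c (1 - x)))" for N x
  define L where "L x = (if \<rho> < success_prob c (1 - x) then (x - 1) powi d * poly q (x - 1) else 0)" for x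
  have nreal: "filterlim (\<lambda>N. real (n N)) at_top sequentially"
    by (rule filterlim_compose[OF filterlim_real_sequentially n])
  have n0: "eventually (\<lambda>N. 0 < n N) sequentially"
    using n[unfolded filterlim_at_top, rule_format, of 1] by (rule eventually_mono) simp
  have ev: "eventually (\<lambda>N. \<forall>j\<le>degree q. n N \<le> B * (r N - j) \<and> nat (- d) \<le> r N - j) sequentially"
  proof -
    have "eventually (\<lambda>N. \<rho> / 2 < real (r N) / real (n N)) sequentially"
      using order_tendstoD(1)[OF ratio, of "\<rho> / 2"] \<open>0 < \<rho>\<close> by simp
    moreover have "eventually (\<lambda>N. 4 / \<rho> * (degree q + nat (- d)) \<le> real (n N)) sequentially"
      using nreal unfolding filterlim_at_top by blast
    ultimately show ?thesis using n0
    proof eventually_elim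
      case (elim N)
      have "\<rho> / 2 * n N < r N" using elim by (simp add: field_simps)
      moreover have big: "real (degree q + nat (- d)) \<le> \<rho> / 4 * n N"
        using elim \<open>0 < \<rho>\<close> by (simp add: field_simps)
      ultimately have rbig: "\<rho> / 4 * n N + real (degree q + nat (- d)) \<le> r N" by (simp add: field_simps)
      show ?case
      proof (intro allI impI)
        fix j assume j: "j \<le> degree q"
        have "\<rho> / 4 * n N \<ge> 0" using \<open>0 < \<rho>\<close> by simp
        then have "degree q + nat (- d) \<le> r N" using rbig by linarith
        then have e: "nat (- d) \<le> r N - j" "real (r N - j) = real (r N) - j" using j by auto
        have "\<rho> / 4 * n N \<le> real (r N - j)" using rbig e j by simp
        then have "real (n N) \<le> 4 / \<rho> * real (r N - j)" using \<open>0 < \<rho>\<close> by (simp add: field_simps)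
        also have "\<dots> \<le> real B * real (r N - j)"
          unfolding B_def by (intro mult_right_mono real_nat_ceiling_ge) auto
        finally have "real (n N) \<le> real (B * (r N - j))" by simp
        then show "n N \<le> B * (r N - j) \<and> nat (- d) \<le> r N - j"
          using e(1) of_nat_le_iff by blast
      qed
    qed
  qed
  have bound: "\<bar>G N x\<bar> \<le> M * S"
    if N: "\<forall>j\<le>degree q. n N \<le> B * (r N - j) \<and> nat (- d) \<le> r N - j" and x: "-1 < x" "x < 1" for N x
  proof -
    have "G N x = (\<Sum>j\<le>degree q. coeff q j * (x - 1) ^ j *
        ((- (1 - x)) powi d * binomial_tail (n N) (r N - j) (success_prob c (1 - x))))"
      unfolding G_def sum_distrib_left by (intro sum.cong refl) simp
    also have "\<bar>\<dots>\<bar> \<le> (\<Sum>j\<le>degree q. (\<bar>coeff q j\<bar> * 2 ^ j) * M)"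
    proof (rule order_trans[OF sum_abs sum_mono])
      fix j assume j: "j \<in> {..degree q}"
      have "\<bar>x - 1\<bar> ^ j \<le> 2 ^ j" using x by (intro power_mono) auto
      moreover have "\<bar>(- (1 - x)) powi d * binomial_tail (n N) (r N - j) (success_prob c (1 - x))\<bar> \<le> M"
        unfolding M_def using N j x by (intro binomial_tail_powi_bound c) auto
      ultimately show "\<bar>coeff q j * (x - 1) ^ j *
        ((- (1 - x)) powi d * binomial_tail (n N) (r N - j) (success_prob c (1 - x)))\<bar>
          \<le> (\<bar>coeff q j\<bar> * 2 ^ j) * M"
        unfolding abs_mult[of "coeff q j * (x - 1) ^ j"] abs_mult[of "coeff q j"] power_abs
        by (intro mult_mono) auto
    qed
    finally show ?thesis 
      unfolding S_def sum_distrib_left by (simp add: mult.commute)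
  qed
  have conv: "(\<lambda>N. G N x) \<longlonglongrightarrow> L x"
    if x: "-1 < x" "x < 1" and ne: "success_prob c (1 - x) \<noteq> \<rho>" for x
  proof -
    let ?p = "success_prob c (1 - x)"
    have p: "0 \<le> ?p" "?p \<le> 1" using success_prob_bounds[OF c, of "1 - x"] x by auto
    have lim: "(\<lambda>N. binomial_tail (n N) (r N - j) ?p) \<longlonglongrightarrow> (if \<rho> < ?p then 1 else 0)" for j
    proof (rule binomial_tail_lln[OF p n _ ne])
      have "(\<lambda>N. real j / real (n N)) \<longlonglongrightarrow> 0"
        by (intro real_tendsto_divide_at_top[OF tendsto_const] nreal)
      with ratio have shifted: "(\<lambda>N. real (r N) / real (n N) - real j / real (n N)) \<longlonglongrightarrow> \<rho> - 0"
        by (rule tendsto_diff)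
      have ge: "eventually (\<lambda>N. j \<le> r N) sequentially"
      proof -
        have "filterlim (\<lambda>N. real (r N) / real (n N) * real (n N)) at_top sequentially"
          by (rule filterlim_tendsto_pos_mult_at_top[OF ratio \<open>0 < \<rho>\<close> nreal])
        then have "eventually (\<lambda>N. real j \<le> real (r N) / real (n N) * real (n N)) sequentially"
          unfolding filterlim_at_top by blast
        then show ?thesis using n0 by eventually_elim simp
      qed
      have "eventually (\<lambda>N. real (r N) / real (n N) - real j / real (n N) = real (r N - j) / real (n N)) sequentially"
        using ge by eventually_elim (simp add: of_nat_diff diff_divide_distrib)
      from Lim_transform_eventually[OF shifted this]
      show "(\<lambda>N. real (r N - j) / real (n N)) \<longlonglongrightarrow> \<rho>" by simp
    qed
    have "(\<lambda>N. G N x) \<longlonglongrightarrow> (x - 1) powi d *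
        (\<Sum>j\<le>degree q. coeff q j * (x - 1) ^ j * (if \<rho> < ?p then 1 else 0))"
      unfolding G_def by (intro tendsto_mult tendsto_sum tendsto_const lim)
    then show ?thesis by (simp add: L_def poly_altdef split: if_splits)
  qed
  obtain N0 where N0: "\<And>N. N0 \<le> N \<Longrightarrow> \<forall>j\<le>degree q. n N \<le> B * (r N - j) \<and> nat (- d) \<le> r N - j"
    using ev unfolding eventually_sequentially by blast
  define H where "H x = indicat_real {-1..1} x *\<^sub>R h x" for x
  have H: "integrable lborel H" using h unfolding set_integrable_def H_def .
  then have [measurable]: "H \<in> borel_measurable lborel" by (rule borel_measurable_integrable)
  have [measurable]: "(\<lambda>x. poly q (x - 1)) \<in> borel_measurable borel"
    by (intro borel_measurable_continuous_onI continuous_intros)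
  have ends: "AE x in lborel. x \<noteq> (1::real)" "AE x in lborel. x \<noteq> (-1::real)"
    by (rule AE_lborel_singleton)+
  \<comment> \<open>The bound holds from \<open>N0\<close> on only, hence the shift of the sequence.\<close>
  have "(\<lambda>N. LBINT x. H x * G (N + N0) x) \<longlonglongrightarrow> (LBINT x. H x * L x)"
  proof (rule integral_dominated_convergence[where w = "\<lambda>x. \<bar>H x\<bar> * (M * S)"])
    show "(\<lambda>x. H x * L x) \<in> borel_measurable lborel"
      unfolding L_def success_prob_def by measurable
    show "(\<lambda>x. H x * G (N + N0) x) \<in> borel_measurable lborel" for N
      unfolding G_def by measurable
    show "integrable lborel (\<lambda>x. \<bar>H x\<bar> * (M * S))" using H by simp
    show "AE x in lborel. (\<lambda>N. H x * G (N + N0) x) \<longlonglongrightarrow> H x * L x"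
      using generic ends
    proof eventually_elim
      case (elim x)
      show ?case
      proof (cases "x \<in> {-1<..<1}")
        case True
        then show ?thesis using elim conv[of x]
          by (intro tendsto_mult tendsto_const LIMSEQ_ignore_initial_segment) auto
      next
        case False
        then have "H x = 0" using elim by (auto simp: H_def indicator_def)
        then show ?thesis by simp
      qed
    qed
    show "AE x in lborel. norm (H x * G (N + N0) x) \<le> \<bar>H x\<bar> * (M * S)" for N
      using ends
    proof eventually_elim
      case (elim x)
      show ?case
      proof (cases "x \<in> {-1<..<1}")
        case True
        then show ?thesis using bound[OF N0[of "N + N0"], of x]
          by (simp add: abs_mult mult_left_mono)
      next
        case False
        then have "H x = 0" using elim by (auto simp: H_def indicator_def)
        then show ?thesis by simp
      qed
    qed
  qed
  then have "(\<lambda>N. LBINT x. H x * G N x) \<longlonglongrightarrow> (LBINT x. H x * L x)"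
    by (rule LIMSEQ_offset)
  moreover have "(LBINT x. H x * L x) =
      (LBINT x:{-1..1}. if \<rho> < success_prob c (1 - x) then h x * ((x - 1) powi d * poly q (x - 1)) else 0)"
    unfolding set_lebesgue_integral_def by (intro Bochner_Integration.integral_cong) (auto simp: H_def L_def)
  moreover have "(LBINT x. H x * G N x) = (LBINT x:{-1..1}. h x * G N x)" for N
    unfolding set_lebesgue_integral_def by (intro Bochner_Integration.integral_cong) (auto simp: H_def)
  ultimately show ?thesis unfolding G_def by simp
qed

section \<open>Determinants and integrals of the limit kernels\<close>

text \<open>A matrix that is block triangular for the preorder given by \<open>key\<close>, with identity blocks on the
  diagonal.  In the Leibniz formula a permutation \<open>p\<close> contributes only if \<open>key (p i) \<le> key i\<close> for
  all \<open>i\<close>; since both sides have the same sum, equality holds throughout.\<close>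

lemma det_triangular_key:
  fixes A :: "'m::finite \<Rightarrow> 'm \<Rightarrow> real" and key :: "'m \<Rightarrow> real"
  assumes less: "\<And>i j. key i < key j \<Longrightarrow> A i j = 0"
    and eq: "\<And>i j. key i = key j \<Longrightarrow> A i j = (if i = j then 1 else 0)"
  shows "det (\<chi> i j. A i j) = 1"
proof -
  have "(\<Prod>i\<in>UNIV. A i (p i)) = 0" if p: "p permutes UNIV" "p \<noteq> id" for p
  proof (rule ccontr)
    assume "(\<Prod>i\<in>UNIV. A i (p i)) \<noteq> 0"
    then have nz: "A i (p i) \<noteq> 0" for i by auto
    have le: "key (p i) \<le> key i" for i using less[of i "p i"] nz[of i] by (rule_tac ccontr) auto
    have "(\<Sum>i\<in>UNIV. key (p i)) = (\<Sum>i\<in>UNIV. key i)"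
      using sum.permute[OF p(1), of key] by (simp add: o_def)
    then have "key (p i) = key i" for i
      by (rule sum_mono_inv) (use le in auto)
    then have "p i = i" for i using eq[of i "p i"] nz[of i] by (auto split: if_splits)
    with p(2) show False by auto
  qed
  then have "det (\<chi> i j. A i j) = (\<Sum>p\<in>{id}. of_int (sign p) * (\<Prod>i\<in>UNIV. A i (p i)))"
    unfolding det_def by (intro sum.mono_neutral_cong_right) (auto simp: permutes_id)
  also have "\<dots> = 1" using eq by simp
  finally show ?thesis .
qed

lemma det_of_real:
  "det (\<chi> i j. complex_of_real (A i j)) = of_real (det (\<chi> i j. A i j))"
  by (simp add: det_def)

lemma tendsto_det:
  fixes A :: "nat \<Rightarrow> 'm::finite \<Rightarrow> 'm \<Rightarrow> real"
  assumes "\<And>i j. (\<lambda>N. A N i j) \<longlonglongrightarrow> B i j"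
  shows "(\<lambda>N. det (\<chi> i j. A N i j)) \<longlonglongrightarrow> det (\<chi> i j. B i j)"
  unfolding det_def by (auto intro!: tendsto_intros assms)

lemma pair_integrand_integrable:
  assumes "a1 \<in> {-1/2, 1/2}" "a2 \<in> {-1/2, 1/2}" "2 * real r1 + a1 \<ge> 2 * real r2 + a2"
  shows "set_integrable lborel {-1..1} (pair_integrand r1 a1 s1 r2 a2 s2)"
proof -
  have "-1/2 \<le> a2" "a1 \<le> 1/2" using assms(1,2) by auto
  then have "real r2 < real r1 + 1" using assms(3) by linarith
  then have le: "r2 \<le> r1" by linarith
  have "set_integrable lborel {-1..1}
     (\<lambda>x. (jacobi a1 s1 x * jacobi a2 s2 x * (x - 1) ^ (r1 - r2)) * jacobi_weight a1 x)"
    unfolding jacobi_real by (rule jacobi_weight_integrable[OF assms(1)]) (intro continuous_intros)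
  moreover have "int r1 - int r2 = int (r1 - r2)" using le by simp
  ultimately show ?thesis by (simp only: pair_integrand_def[abs_def] power_int_of_nat)
qed

text \<open>Equality of \<open>2 r + a\<close> determines \<open>r\<close> and \<open>a\<close>, because \<open>a = k - 1/2\<close> with \<open>k \<in> {0, 1}\<close>.\<close>

lemma pair_integrand_gram:
  assumes a: "a1 \<in> {-1/2, 1/2}" "a2 \<in> {-1/2, 1/2}" and eq: "2 * real r1 + a1 = 2 * real r2 + a2"
  shows "r1 = r2" "a1 = a2"
    and "W a1 s1 / pi * (LBINT x:{-1..1}. pair_integrand r1 a1 s1 r2 a2 s2 x) = (if s1 = s2 then 1 else 0)"
proof -
  have half: "\<exists>k\<le>1. b = real k - 1/2" if "b \<in> {-1/2, 1/2}" for b :: real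
    using that by (auto intro: exI[of _ "0::nat"] exI[of _ "1::nat"])
  obtain k1 k2 :: nat where k: "k1 \<le> 1" "k2 \<le> 1" "a1 = real k1 - 1/2" "a2 = real k2 - 1/2"
    using half[OF a(1)] half[OF a(2)] by blast
  have "real (2 * r1 + k1) = real (2 * r2 + k2)" using eq k by simp
  then have "2 * r1 + k1 = 2 * r2 + k2" by (simp only: of_nat_eq_iff)
  then show "r1 = r2" using k(1,2) by presburger
  with eq show "a1 = a2" by simp
  with \<open>r1 = r2\<close> show "W a1 s1 / pi * (LBINT x:{-1..1}. pair_integrand r1 a1 s1 r2 a2 s2 x) = (if s1 = s2 then 1 else 0)"
    using jacobi_orthonormal[OF a(1), of s1 s2] by (simp add: pair_integrand_def)
qed

lemma set_integral_split:
  fixes f :: "real \<Rightarrow> real"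
  assumes "-1 \<le> \<theta>" "\<theta> \<le> 1" and f: "set_integrable lborel {-1..1} f"
  shows "(LBINT x:{-1..1}. f x) = (LBINT x:{-1..\<theta>}. f x) + (LBINT x:{\<theta>..1}. f x)"
proof -
  have "(LBINT x:{-1..1}. f x) = (LBINT x:{-1..<\<theta>} \<union> {\<theta>..1}. f x)"
    using assms by (simp add: ivl_disj_un)
  also have "\<dots> = (LBINT x:{-1..<\<theta>}. f x) + (LBINT x:{\<theta>..1}. f x)"
    using assms by (intro set_integral_Un set_integrable_subset[OF f]) auto
  also have "(LBINT x:{-1..<\<theta>}. f x) = (LBINT x:{-1..\<theta>}. f x)"
    by (rule set_integral_discrete_difference[where X = "{\<theta>}"]) (use assms in auto)
  finally show ?thesis .
qed

text \<open>The critical ratio \<open>l / t\<close> is the success probability at the left end point \<open>x = -1\<close>.\<close>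

lemma one_minus_powi_eq:
  assumes "0 \<le> \<alpha>"
  shows "1 - (1 + \<alpha>) powi (-2) = 2 * phi_slope \<alpha> / (1 + 2 * phi_slope \<alpha>)"
proof -
  have "(1 + \<alpha>)\<^sup>2 = 1 + 2 * phi_slope \<alpha>" by (simp add: phi_slope_def power2_eq_square algebra_simps)
  moreover have "(1 + \<alpha>) powi (-2) = 1 / (1 + \<alpha>)\<^sup>2"
    using assms by (simp add: power_int_minus divide_inverse)
  moreover have "0 < 1 + 2 * phi_slope \<alpha>" using assms by (simp add: phi_slope_def add_pos_nonneg)
  ultimately show ?thesis by (simp add: diff_divide_eq_iff)
qed

section \<open>Limit of the determinants\<close>

theorem theorem4p1:
  fixes \<alpha> t l \<theta> :: real
    and n :: "nat \<Rightarrow> nat"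
    and r :: "nat \<Rightarrow> 'm::finite \<Rightarrow> nat"
    and s :: "'m \<Rightarrow> nat"
    and a :: "'m \<Rightarrow> real"
    and C :: "real \<Rightarrow> complex"
  assumes alpha: "\<alpha> \<ge> 0" and t: "t > 0" and l: "l > 0"
    and n_lim: "(\<lambda>N. real (n N) / real N) \<longlonglongrightarrow> t"
    and r_pos: "\<And>N i. r N i > 0"
    and r_lim: "\<And>i. (\<lambda>N. real (r N i) / real N) \<longlonglongrightarrow> l"
    and r_diff: "\<And>i j. \<exists>d::int. \<forall>N. int (r N i) - int (r N j) = d"
    and a: "\<And>i. a i \<in> {-1/2, 1/2}"
    and C: "pos_simple_loop_around C (complex_of_real ` {-1..1})"
    and theta: "\<theta> = 1 + 2 * l / ((l - t) * (2 * \<alpha> + \<alpha>\<^sup>2))"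
    and distinct_points:
      "l \<ge> (1 - (1 + \<alpha>) powi (-2)) * t \<longrightarrow> (\<forall>N. inj (\<lambda>i. (r N i, a i, s i)))"
  shows "\<forall>M. (\<lambda>N. det ((\<chi> i j. kernel_K \<alpha> (n N) C (r N i) (a i) (s i) (r N j) (a j) (s j))
                     :: complex ^ 'm ^ 'm))
           \<longlonglongrightarrow>
           (if l \<ge> (1 - (1 + \<alpha>) powi (-2)) * t then 1
            else complex_of_real (det ((\<chi> i j. kernel_L (r M i) (a i) (s i) (r M j) (a j) (s j) \<theta>)
                     :: real ^ 'm ^ 'm)))"
proof
  fix M
  define c where "c = phi_slope \<alpha>"
  define \<rho> where "\<rho> = l / t"
  have c0: "0 \<le> c" using alpha by (simp add: c_def phi_slope_def)
  have \<rho>: "0 < \<rho>" using l t by (simp add: \<rho>_def)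
  have thr: "1 - (1 + \<alpha>) powi (-2) = 2 * c / (1 + 2 * c)"
    unfolding c_def by (rule one_minus_powi_eq[OF alpha])
  have n_inf: "filterlim n at_top sequentially"
  proof -
    have lim: "filterlim (\<lambda>N. real (n N) / real N * real N) at_top sequentially"
      by (rule filterlim_tendsto_pos_mult_at_top[OF n_lim t filterlim_real_sequentially])
    have ev: "eventually (\<lambda>N. real (n N) / real N * real N = real (n N)) sequentially"
      by (rule eventually_mono[OF eventually_gt_at_top[of 0]]) simp
    have "filterlim (\<lambda>N. real (n N)) at_top sequentially"
      by (rule iffD1[OF filterlim_cong[OF refl refl ev] lim])
    then show ?thesis by (simp add: filterlim_sequentially_iff_filterlim_real)
  qed
  have ratio: "(\<lambda>N. real (r N i) / real (n N)) \<longlonglongrightarrow> \<rho>" for i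
  proof -
    have "(\<lambda>N. (real (r N i) / real N) / (real (n N) / real N)) \<longlonglongrightarrow> \<rho>"
      unfolding \<rho>_def using t by (intro tendsto_divide r_lim n_lim) auto
    moreover have "eventually (\<lambda>N. (real (r N i) / real N) / (real (n N) / real N)
        = real (r N i) / real (n N)) sequentially"
      by (rule eventually_mono[OF eventually_gt_at_top[of 0]]) simp
    ultimately show ?thesis by (rule Lim_transform_eventually)
  qed
  define P where "P i j = pair_integrand (r M i) (a i) (s i) (r M j) (a j) (s j)" for i j
  define ge where "ge i j \<longleftrightarrow> 2 * real (r M i) + a i \<ge> 2 * real (r M j) + a j" for i j
  define I where "I i j = (if ge i j then W (a i) (s i) / pi * (LBINT x:{-1..1}. P i j x) else 0)" for i j
  define T where "T N i j = (LBINT x:{-1..1}. tail_integrand \<alpha> (n N) (r N i) (a i) (s i) (r N j) (a j) (s j) x)"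
    for N i j
  have diff: "int (r N i) - int (r N j) = int (r M i) - int (r M j)" for N i j
    using r_diff[of i j] by metis
  have diff': "real (r N i) - real (r N j) = real (r M i) - real (r M j)" for N i j
    using arg_cong[OF diff[of N i j], of real_of_int] by simp
  have K: "kernel_K \<alpha> (n N) C (r N i) (a i) (s i) (r N j) (a j) (s j)
      = of_real (I i j - W (a i) (s i) / pi * T N i j)" for N i j
  proof -
    have "(2 * real (r N i) + a i \<ge> 2 * real (r N j) + a j) = ge i j"
      using diff'[of N i j] unfolding ge_def by linarith
    moreover have "pair_integrand (r N i) (a i) (s i) (r N j) (a j) (s j) = P i j"
      unfolding pair_integrand_def P_def diff[of N i j] ..
    ultimately show ?thesis
      unfolding kernel_K_eq[OF C alpha] I_def T_def by simp
  qed
  have T_lim: "(\<lambda>N. T N i j) \<longlonglongrightarrow> (LBINT x:{-1..1}. if \<rho> < success_prob c (1 - x) then P i j x else 0)"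
    if generic: "AE x in lborel. x \<in> {-1<..<1} \<longrightarrow> success_prob c (1 - x) \<noteq> \<rho>" for i j
  proof -
    have "set_integrable lborel {-1..1} (\<lambda>x. jacobi (a i) (s i) x * jacobi_weight (a i) x)"
      using a unfolding jacobi_real by (intro jacobi_weight_integrable continuous_intros) auto
    note lim = tail_integral_limit[OF c0 this n_inf ratio[of j] \<rho> generic,
        of "int (r M i) - int (r M j)" "shifted_jacobi (a j) (s j)"]
    have T_eq: "T N i j = (LBINT x:{-1..1}. jacobi (a i) (s i) x * jacobi_weight (a i) x *
        ((x - 1) powi (int (r M i) - int (r M j)) *
          (\<Sum>k\<le>degree (shifted_jacobi (a j) (s j)). coeff (shifted_jacobi (a j) (s j)) k * (x - 1) ^ k *
             binomial_tail (n N) (r N j - k) (success_prob c (1 - x)))))" for N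
      unfolding T_def tail_integrand_def diff[of N i j] c_def ..
    have P_eq: "jacobi (a i) (s i) x * jacobi_weight (a i) x *
        ((x - 1) powi (int (r M i) - int (r M j)) * poly (shifted_jacobi (a j) (s j)) (x - 1)) = P i j x" for x
      unfolding P_def pair_integrand_def jacobi_eq_poly_shifted[of "a j" "s j", symmetric]
      by (simp only: mult_ac)
    show ?thesis using lim unfolding T_eq P_eq .
  qed
  have det_lim: "(\<lambda>N. det ((\<chi> i j. kernel_K \<alpha> (n N) C (r N i) (a i) (s i) (r N j) (a j) (s j))
       :: complex ^ 'm ^ 'm)) \<longlonglongrightarrow> of_real (det (\<chi> i j. L i j))"
    if "\<And>i j. (\<lambda>N. I i j - W (a i) (s i) / pi * T N i j) \<longlonglongrightarrow> L i j" for L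
    unfolding K det_of_real by (intro tendsto_of_real tendsto_det that)
  show "(\<lambda>N. det ((\<chi> i j. kernel_K \<alpha> (n N) C (r N i) (a i) (s i) (r N j) (a j) (s j))
                     :: complex ^ 'm ^ 'm))
           \<longlonglongrightarrow>
           (if l \<ge> (1 - (1 + \<alpha>) powi (-2)) * t then 1
            else complex_of_real (det ((\<chi> i j. kernel_L (r M i) (a i) (s i) (r M j) (a j) (s j) \<theta>)
                     :: real ^ 'm ^ 'm)))"
  proof (cases "l \<ge> (1 - (1 + \<alpha>) powi (-2)) * t")
    case True
    \<comment> \<open>At or above the critical ratio the success probability stays below \<open>\<rho>\<close> on the open interval, so
      the double integral disappears in the limit.\<close>
    have low: "success_prob c (1 - x) < \<rho>" if x: "-1 < x" "x < 1" for x
    proof (cases "c = 0")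
      case False
      then have cp: "0 < c" using c0 by simp
      have "c * (1 - x) < 2 * c" using cp x by simp
      moreover have "0 < 1 + c * (1 - x)" using cp x by (simp add: add_pos_pos)
      ultimately have "success_prob c (1 - x) < 2 * c / (1 + 2 * c)"
      proof -
        have "c * (1 - x) * (1 + 2 * c) < 2 * c * (1 + c * (1 - x))"
          using \<open>c * (1 - x) < 2 * c\<close> by argo
        then have "c * (1 - x) < 2 * c * (1 + c * (1 - x)) / (1 + 2 * c)"
          using cp by (simp only: pos_less_divide_eq)
        then show ?thesis
          unfolding success_prob_def pos_divide_less_eq[OF \<open>0 < 1 + c * (1 - x)\<close>] by simp
      qed
      also have "\<dots> \<le> \<rho>" using True t unfolding thr \<rho>_def by (simp add: pos_le_divide_eq)
      finally show ?thesis .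
    qed (simp add: success_prob_def \<rho>)
    have "(\<lambda>N. T N i j) \<longlonglongrightarrow> 0" for i j
    proof -
      have "(LBINT x:{-1..1}. if \<rho> < success_prob c (1 - x) then P i j x else 0) = (LBINT x:{-1..1::real}. (0::real))"
        by (rule set_integral_Icc_cong_open) (use low in force)
      moreover have "AE x in lborel. x \<in> {-1<..<1} \<longrightarrow> success_prob c (1 - x) \<noteq> \<rho>"
        using low by (intro AE_I2) force
      ultimately show ?thesis using T_lim[of i j] by simp
    qed
    then have "(\<lambda>N. I i j - W (a i) (s i) / pi * T N i j) \<longlonglongrightarrow> I i j - W (a i) (s i) / pi * 0" for i j
      by (intro tendsto_intros)
    then have "(\<lambda>N. det ((\<chi> i j. kernel_K \<alpha> (n N) C (r N i) (a i) (s i) (r N j) (a j) (s j))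
       :: complex ^ 'm ^ 'm)) \<longlonglongrightarrow> of_real (det (\<chi> i j. I i j))"
      by (intro det_lim) simp
    moreover have "det (\<chi> i j. I i j) = 1"
    proof (rule det_triangular_key)
      fix i j
      assume eq: "2 * real (r M i) + a i = 2 * real (r M j) + a j"
      note gram = pair_integrand_gram[OF a a eq]
      have "I i j = (if s i = s j then 1 else 0)"
        using gram(3)[of "s i" "s j"] eq by (simp add: I_def ge_def P_def)
      moreover have "inj (\<lambda>i. (r M i, a i, s i))" using distinct_points True by blast
      then have "s i = s j \<longleftrightarrow> i = j" using gram(1,2) by (auto simp: inj_def)
      ultimately show "I i j = (if i = j then 1 else 0)" by simp
    qed (simp add: I_def ge_def)
    ultimately show ?thesis using True by simp
  next
    case False
    then have lt: "l < 2 * c / (1 + 2 * c) * t" unfolding thr by simp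
    have cp: "0 < c" using lt l c0 by (cases "c = 0") auto
    \<comment> \<open>The success probability is decreasing in \<open>x\<close> and equals \<open>\<rho>\<close> at \<open>x = \<theta>\<close>, which lies in \<open>(-1, 1)\<close>.\<close>
    have key: "l * (1 + 2 * c) < 2 * c * t" using lt cp by (simp add: pos_less_divide_eq)
    have lt_t: "l < t"
    proof (rule ccontr)
      assume "\<not> l < t"
      then have "2 * c * t \<le> 2 * c * l" using cp by simp
      with key l show False by (simp add: algebra_simps)
    qed
    have \<theta>: "\<theta> = 1 - l / (c * (t - l))"
    proof -
      have "2 * \<alpha> + \<alpha>\<^sup>2 = 2 * c" by (simp add: c_def phi_slope_def)
      then have "\<theta> = 1 + l / ((l - t) * c)" unfolding theta by simp
      also have "(l - t) * c = - (c * (t - l))" by (simp add: algebra_simps)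
      finally show ?thesis by simp
    qed
    have den: "0 < c * (t - l)" using cp lt_t by simp
    have \<theta>_bounds: "-1 < \<theta>" "\<theta> < 1"
    proof -
      have "l / (c * (t - l)) < 2" using den key by (simp add: pos_divide_less_eq algebra_simps)
      then show "-1 < \<theta>" unfolding \<theta> by simp
      show "\<theta> < 1" unfolding \<theta> using den l by simp
    qed
    have cmp: "(\<rho> < success_prob c (1 - x) \<longleftrightarrow> x < \<theta>)" "success_prob c (1 - x) = \<rho> \<longleftrightarrow> x = \<theta>"
      if x: "x < 1" for x
    proof -
      have pos: "0 < 1 + c * (1 - x)" using cp x by (simp add: add_pos_pos)
      have "\<rho> < success_prob c (1 - x) \<longleftrightarrow> l < c * (1 - x) / (1 + c * (1 - x)) * t"
        unfolding \<rho>_def success_prob_def by (rule pos_divide_less_eq[OF t])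
      also have "\<dots> \<longleftrightarrow> l * (1 + c * (1 - x)) < c * (1 - x) * t"
        unfolding times_divide_eq_left by (rule pos_less_divide_eq[OF pos])
      also have "\<dots> \<longleftrightarrow> l < (1 - x) * (c * (t - l))" by argo
      also have "\<dots> \<longleftrightarrow> x < \<theta>" unfolding \<theta> using den by (simp add: pos_divide_less_eq[symmetric] less_diff_eq add.commute)
      finally show "\<rho> < success_prob c (1 - x) \<longleftrightarrow> x < \<theta>" .
      have "success_prob c (1 - x) = \<rho> \<longleftrightarrow> c * (1 - x) * t = l * (1 + c * (1 - x))"
        unfolding \<rho>_def success_prob_def using pos t by (intro frac_eq_eq) auto
      also have "\<dots> \<longleftrightarrow> l = (1 - x) * (c * (t - l))" by argo
      also have "\<dots> \<longleftrightarrow> l / (c * (t - l)) = 1 - x" using cp lt_t by (simp add: divide_eq_eq)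
      also have "\<dots> \<longleftrightarrow> x = \<theta>" unfolding \<theta> by linarith
      finally show "success_prob c (1 - x) = \<rho> \<longleftrightarrow> x = \<theta>" .
    qed
    have T_lim': "(\<lambda>N. T N i j) \<longlonglongrightarrow> (LBINT x:{-1..\<theta>}. P i j x)" for i j
    proof -
      have "AE x in lborel. x \<noteq> \<theta>" by (rule AE_lborel_singleton)
      then have "AE x in lborel. x \<in> {-1<..<1} \<longrightarrow> success_prob c (1 - x) \<noteq> \<rho>"
        by eventually_elim (use cmp in auto)
      moreover have "(LBINT x:{-1..1}. if \<rho> < success_prob c (1 - x) then P i j x else 0)
          = (LBINT x:{-1..\<theta>}. P i j x)"
        \<comment> \<open>The comparison with \<open>\<theta>\<close> needs \<open>x < 1\<close>; the null set \<open>{\<theta>, 1}\<close> is discarded.\<close>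
        unfolding set_lebesgue_integral_def
        by (rule integral_discrete_difference[where X = "{\<theta>, 1}"])
           (use cmp \<theta>_bounds in \<open>auto simp: indicator_def\<close>)
      ultimately show ?thesis using T_lim[of i j] by simp
    qed
    \<comment> \<open>The single integral, if present, is cancelled on \<open>[-1, \<theta>]\<close>.\<close>
    have L: "I i j - W (a i) (s i) / pi * (LBINT x:{-1..\<theta>}. P i j x)
        = kernel_L (r M i) (a i) (s i) (r M j) (a j) (s j) \<theta>" for i j
    proof (cases "ge i j")
      case True
      have "set_integrable lborel {-1..1} (P i j)"
        using a True unfolding P_def ge_def by (intro pair_integrand_integrable) auto
      then have "(LBINT x:{-1..1}. P i j x) = (LBINT x:{-1..\<theta>}. P i j x) + (LBINT x:{\<theta>..1}. P i j x)"
        using \<theta>_bounds by (intro set_integral_split) auto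
      then show ?thesis using True
        by (simp add: I_def kernel_L_def ge_def P_def algebra_simps)
    next
      case False
      then show ?thesis by (simp add: I_def kernel_L_def ge_def P_def)
    qed
    have lim: "(\<lambda>N. I i j - W (a i) (s i) / pi * T N i j)
        \<longlonglongrightarrow> kernel_L (r M i) (a i) (s i) (r M j) (a j) (s j) \<theta>" for i j
      unfolding L[symmetric] by (intro tendsto_intros T_lim')
    show ?thesis unfolding if_not_P[OF False] by (rule det_lim[OF lim])
  qed
qed

end
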